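(* Let $(G,E)$ be a self-similar action and consider the following conditions: (Cyc) every $G$-cycle has an entrance; (Evr) if $g\in G$ fixes every path in $s(g)E^*$, then $g$ strongly fixes some path in $s(g)E^*$; (Rec) if $g\in G$ fixes some $\alpha\in E^*$ such that $s(\alpha)$ is a finite receiver, then $\alpha$ is strongly $g$-fixed. Then the following statements are true: (1) $\mathcal G(G,E)$ is topologically free if and only if (Evr) and (Cyc) hold. (2) Topological freeness of any of $\mathcal G_0(G,E)$ and $\mathcal G_{00}(G,E)$ is equivalent to (Evr). (3) Topological freeness of any of the groupoids $\widetilde{\mathcal G}(G,E)$, $\widetilde{\mathcal G}_0(G,E)$ and $\widetilde{\mathcal G}_{00}(G,E)$ is equivalent to (Evr) and (Rec).
   Context: An étale groupoid $\mathcal G$ with unit space $X$ is topologically free if $\{\gamma\in\mathcal G:r(\gamma)=s(\gamma)\}\setminus X$ has empty interior in $\mathcal G$. A directed graph $E=(E^0,E^1,r,s)$ has vertices $E^0$, edges $E^1$, and maps $r,s:E^1\to E^0$. For $n\ge1$, $E^n$ is the set of paths $\mu=\mu_1\cdots\mu_n$ ($\mu_i\in E^1$, $s(\mu_i)=r(\mu_{i+1})$), $r(\mu)=r(\mu_1)$, $s(\mu)=s(\mu_n)$, $|\mu|=n$; vertices are paths of length $0$ with $r(v)=s(v)=v$; $E^*=\bigcup_{n\ge0}E^n$; $E^\infty$ is the set of infinite paths; $vE^n,vE^*$ denote paths with range $v$. $\beta$ is a prefix of $\alpha$ if $\alpha=\beta\beta'$. A vertex $v$ is a finite receiver if $vE^1$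 is finite (possibly empty), and singular if $vE^1$ is empty or infinite. A path $\alpha=\alpha_1\cdots\alpha_n$ has an entrance if one of $r(\alpha_1),\dots,r(\alpha_n),s(\alpha_n)$ is the range of two distinct edges. $(G,E)$ is a self-similar action if $G$ is a discrete groupoid with $G^0=E^0$, equipped with a left action $(g,e)\mapsto ge$ on $E^1$ (defined when $s(g)=r(e)$, with $r(ge)=r(g)$, $(hg)e=h(ge)$, $r(e)e=e$) and a map $(g,e)\mapsto g|_e\in G$ with $(hg)|_e=h|_{ge}\,g|_e$, $s(g|_e)=s(e)$, $r(g|_e)=s(ge)$. It extends to paths by $g\,s(g)=r(g)$, $g|_{s(g)}=g$, $g(e\mu)=(ge)(g|_e\mu)$, $g|_{e\mu}=(g|_e)|_\mu$, and to infinite paths by $g(\mu_1\mu_2\cdots)=(g\mu_1)(g|_{\mu_1}\mu_2)(g|_{\mu_1\mu_2}\mu_3)\cdots$. $g$ fixes $\mu$ if $g\mu=\mu$; $\mu\in s(g)E^*$ is strongly $g$-fixed if $g\mu=\mu$ and $g|_\mu=s(\mu)$. A $G$-cycle is a path $\alpha\in E^*\setminus E^0$ such that there is $g\in G$ with $s(g)=s(\alpha)$, $r(g)=r(\alpha)$. $E^{\le\infty}=E^*\cup E^\infty$; $Z(\alpha)$ is the set of elements of $E^{\le\infty}$ with prefix $\alpha$; the sets $Z(\alpha)\setminus\bigcup_{\beta\in F}Z(\alpha\beta)$ ($F\subseteq s(\alpha)E^*$ finite) form a basis of the topology. $\partial E=E^\infty\cup\{\mu\in E^*:s(\mu)\text{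 singular}\}$. $\widetilde{\mathcal G}(G,E)$ consists of classes $[\alpha,g,\beta;\xi]$, where $\alpha,\beta\in E^*$, $g\in G$, $r(g)=s(\alpha)$, $s(g)=s(\beta)$, $\xi\in Z(\beta)$, and $[\alpha,g,\beta;\xi]=[\gamma,h,\delta;\eta]$ iff $\xi=\eta$ and there are $\beta',\delta'\in E^*$ with $\beta\beta'=\delta\delta'$ a prefix of $\xi$, $\alpha(g\beta')=\gamma(h\delta')$ and $g|_{\beta'}=h|_{\delta'}$. The source of $[\alpha,g,\beta;\beta\xi]$ is $\beta\xi$, its range is $\alpha(g\xi)$; products are $[s;\xi][t;\eta]=[st;\eta]$ (when composable), where $(\alpha,g,\beta)(\gamma,h,\delta)=(\alpha(g\beta'),g|_{\beta'}h,\delta)$ if $\gamma=\beta\beta'$ and $=(\alpha,g(h^{-1}|_{\gamma'})^{-1},\delta(h^{-1}\gamma'))$ if $\beta=\gamma\gamma'$; $\xi\in E^{\le\infty}$ is identified with the unit $[r(\xi),r(\xi),r(\xi);\xi]$, so the unit space is $E^{\le\infty}$; basic open sets are $\{[\alpha,g,\beta;\xi]:\xi\in V\}$, $V\subseteq Z(\beta)$ open. $\mathcal G(G,E)$ is its restriction to $\partial E$. $\widetilde{\mathcal G}_0(G,E)=\{[\alpha,g,\beta;\xi]:|\alpha|=|\beta|\}$, $\widetilde{\mathcal G}_{00}(G,E)=\{[g\beta,g|_\beta,\beta;\beta\xi]:s(g)=r(\beta),\ \xi\in s(\beta)E^{\le\infty}\}$, and $\mathcal G_0(G,E)$, $\mathcal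 G_{00}(G,E)$ are their intersections with $\mathcal G(G,E)$. *)

theory Defs
  imports
    "HOL-Analysis.Analysis"
    "HOL-Library.Stream"
    "Graph_Theory.Digraph"
begin

section \<open>Groupoids\<close>

text \<open>
  A groupoid has objects \<open>gobj\<close> and arrows \<open>garr\<close>; \<open>gid\<close> embeds the objects as units.
  The product \<open>gcomp G g h\<close> is meaningful only if \<open>gsrc G g = grng G h\<close>.
\<close>

record ('x, 'g) groupoid =
  gobj :: "'x set"
  garr :: "'g set"
  gsrc :: "'g \<Rightarrow> 'x"
  grng :: "'g \<Rightarrow> 'x"
  gid :: "'x \<Rightarrow> 'g"
  gcomp :: "'g \<Rightarrow> 'g \<Rightarrow> 'g"

definition is_inverse :: "('x, 'g, 'z) groupoid_scheme \<Rightarrow> 'g \<Rightarrow> 'g \<Rightarrow> bool" where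
  "is_inverse G g h \<longleftrightarrow>
     h \<in> garr G \<and> gsrc G h = grng G g \<and> grng G h = gsrc G g \<and>
     gcomp G h g = gid G (gsrc G g) \<and> gcomp G g h = gid G (grng G g)"

definition ginv :: "('x, 'g, 'z) groupoid_scheme \<Rightarrow> 'g \<Rightarrow> 'g" where
  "ginv G g = (THE h. is_inverse G g h)"

locale groupoid =
  fixes G :: "('x, 'g, 'z) groupoid_scheme"
  assumes src_closed: "g \<in> garr G \<Longrightarrow> gsrc G g \<in> gobj G"
    and rng_closed: "g \<in> garr G \<Longrightarrow> grng G g \<in> gobj G"
    and id_closed: "x \<in> gobj G \<Longrightarrow> gid G x \<in> garr G"
    and src_id: "x \<in> gobj G \<Longrightarrow> gsrc G (gid G x) = x"
    and rng_id: "x \<in> gobj G \<Longrightarrow> grng G (gid G x) = x"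
    and comp_closed: "\<lbrakk>g \<in> garr G; h \<in> garr G; gsrc G g = grng G h\<rbrakk> \<Longrightarrow> gcomp G g h \<in> garr G"
    and src_comp: "\<lbrakk>g \<in> garr G; h \<in> garr G; gsrc G g = grng G h\<rbrakk>
        \<Longrightarrow> gsrc G (gcomp G g h) = gsrc G h"
    and rng_comp: "\<lbrakk>g \<in> garr G; h \<in> garr G; gsrc G g = grng G h\<rbrakk>
        \<Longrightarrow> grng G (gcomp G g h) = grng G g"
    and comp_assoc: "\<lbrakk>g \<in> garr G; h \<in> garr G; k \<in> garr G; gsrc G g = grng G h; gsrc G h = grng G k\<rbrakk>
        \<Longrightarrow> gcomp G (gcomp G g h) k = gcomp G g (gcomp G h k)"
    and comp_id_left: "g \<in> garr G \<Longrightarrow> gcomp G (gid G (grng G g)) g = g"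
    and comp_id_right: "g \<in> garr G \<Longrightarrow> gcomp G g (gid G (gsrc G g)) = g"
    and ex_inverse: "g \<in> garr G \<Longrightarrow> \<exists>h. is_inverse G g h"

record ('x, 'g) top_groupoid = "('x, 'g) groupoid" +
  gtop :: "'g topology"

definition topologically_free :: "('x, 'g, 'z) top_groupoid_scheme \<Rightarrow> bool" where
  "topologically_free \<G> \<longleftrightarrow>
     gtop \<G> interior_of ({\<gamma> \<in> garr \<G>. grng \<G> \<gamma> = gsrc \<G> \<gamma>} - gid \<G> ` gobj \<G>) = {}"

definition restrict_objects ::
  "('x, 'g) top_groupoid \<Rightarrow> 'x set \<Rightarrow> ('x, 'g) top_groupoid" where
  "restrict_objects \<G> Y =
     (let A = {\<gamma> \<in> garr \<G>. gsrc \<G> \<gamma> \<in> Y \<and> grng \<G> \<gamma> \<in> Y}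
      in \<G>\<lparr>gobj := gobj \<G> \<inter> Y, garr := A, gtop := subtopology (gtop \<G>) A\<rparr>)"

text \<open>The following is used only for sets \<open>A\<close> of arrows that contain all units.\<close>

definition restrict_arrows ::
  "('x, 'g) top_groupoid \<Rightarrow> 'g set \<Rightarrow> ('x, 'g) top_groupoid" where
  "restrict_arrows \<G> A = \<G>\<lparr>garr := garr \<G> \<inter> A, gtop := subtopology (gtop \<G>) (garr \<G> \<inter> A)\<rparr>"


section \<open>Paths in directed graphs\<close>

text \<open>
  For an edge \<open>e\<close>, the source is \<open>tail E e\<close> and the range is \<open>head E e\<close>. In a path
  \<open>e\<^sub>1 e\<^sub>2 \<dots>\<close> the source of each edge is the range of the next one.
  \<open>FPath v es\<close> is the finite path with range \<open>v\<close> and edges \<open>es\<close>; in particular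
  \<open>FPath v []\<close> is the vertex \<open>v\<close> as a path of length zero.
\<close>

datatype ('v, 'e) epath = FPath 'v "'e list" | IPath "'e stream"

definition fpaths :: "('v, 'e) pre_digraph \<Rightarrow> ('v, 'e) epath set" where
  "fpaths E = {FPath v es |v es. v \<in> verts E \<and> set es \<subseteq> arcs E \<and>
     (\<forall>i. Suc i < length es \<longrightarrow> tail E (es ! i) = head E (es ! Suc i)) \<and>
     (es \<noteq> [] \<longrightarrow> v = head E (hd es))}"

definition ipaths :: "('v, 'e) pre_digraph \<Rightarrow> ('v, 'e) epath set" where
  "ipaths E = {IPath t |t. \<forall>i. t !! i \<in> arcs E \<and> tail E (t !! i) = head E (t !! Suc i)}"

definition epaths :: "('v, 'e) pre_digraph \<Rightarrow> ('v, 'e) epath set" where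
  "epaths E = fpaths E \<union> ipaths E"

primrec plength :: "('v, 'e) epath \<Rightarrow> enat" where
  "plength (FPath v es) = enat (length es)"
| "plength (IPath t) = \<infinity>"

primrec prange :: "('v, 'e) pre_digraph \<Rightarrow> ('v, 'e) epath \<Rightarrow> 'v" where
  "prange E (FPath v es) = v"
| "prange E (IPath t) = head E (shd t)"

primrec psource :: "('v, 'e) pre_digraph \<Rightarrow> ('v, 'e) epath \<Rightarrow> 'v" where
  "psource E (FPath v es) = (if es = [] then v else tail E (last es))"
| "psource E (IPath t) = undefined"

text \<open>Concatenation is meaningful only for a finite first path whose source is the range of
  the second path.\<close>

fun pcat :: "('v, 'e) epath \<Rightarrow> ('v, 'e) epath \<Rightarrow> ('v, 'e) epath" where
  "pcat (FPath v es) (FPath w fs) = FPath v (es @ fs)"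
| "pcat (FPath v es) (IPath t) = IPath (es @- t)"
| "pcat (IPath t) \<xi> = IPath t"

definition fpaths_at :: "('v, 'e) pre_digraph \<Rightarrow> 'v \<Rightarrow> ('v, 'e) epath set" where
  "fpaths_at E v = {\<mu> \<in> fpaths E. prange E \<mu> = v}"

definition epaths_at :: "('v, 'e) pre_digraph \<Rightarrow> 'v \<Rightarrow> ('v, 'e) epath set" where
  "epaths_at E v = {\<mu> \<in> epaths E. prange E \<mu> = v}"

definition cylinder :: "('v, 'e) pre_digraph \<Rightarrow> ('v, 'e) epath \<Rightarrow> ('v, 'e) epath set" where
  "cylinder E \<alpha> = {pcat \<alpha> \<xi> |\<xi>. \<xi> \<in> epaths_at E (psource E \<alpha>)}"

definition edges_at :: "('v, 'e) pre_digraph \<Rightarrow> 'v \<Rightarrow> 'e set" where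
  "edges_at E v = {e \<in> arcs E. head E e = v}"

definition finite_receiver :: "('v, 'e) pre_digraph \<Rightarrow> 'v \<Rightarrow> bool" where
  "finite_receiver E v \<longleftrightarrow> v \<in> verts E \<and> finite (edges_at E v)"

definition singular :: "('v, 'e) pre_digraph \<Rightarrow> 'v \<Rightarrow> bool" where
  "singular E v \<longleftrightarrow> v \<in> verts E \<and> (edges_at E v = {} \<or> infinite (edges_at E v))"

definition boundary_paths :: "('v, 'e) pre_digraph \<Rightarrow> ('v, 'e) epath set" where
  "boundary_paths E = ipaths E \<union> {\<mu> \<in> fpaths E. singular E (psource E \<mu>)}"

primrec path_edges :: "('v, 'e) epath \<Rightarrow> 'e set" where
  "path_edges (FPath v es) = set es"
| "path_edges (IPath t) = sset t"

definition has_entrance :: "('v, 'e) pre_digraph \<Rightarrow> ('v, 'e) epath \<Rightarrow> bool" where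
  "has_entrance E \<alpha> \<longleftrightarrow>
     (\<exists>v \<in> insert (psource E \<alpha>) (head E ` path_edges \<alpha>).
        \<exists>e \<in> edges_at E v. \<exists>f \<in> edges_at E v. e \<noteq> f)"

text \<open>These sets are closed under finite intersections up to unions, so they form a basis of
  the topology they generate.\<close>

definition path_topology :: "('v, 'e) pre_digraph \<Rightarrow> ('v, 'e) epath topology" where
  "path_topology E = topology_generated_by
     {cylinder E \<alpha> - (\<Union>\<beta>\<in>F. cylinder E (pcat \<alpha> \<beta>)) |\<alpha> F.
        \<alpha> \<in> fpaths E \<and> finite F \<and> F \<subseteq> fpaths_at E (psource E \<alpha>)}"


section \<open>Self-similar actions\<close>

record ('v, 'g, 'e) self_similar = "('v, 'g) groupoid" +
  act :: "'g \<Rightarrow> 'e \<Rightarrow> 'e"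
  restr :: "'g \<Rightarrow> 'e \<Rightarrow> 'g"

locale self_similar_action = groupoid G + wf_digraph E
  for G :: "('v, 'g, 'e) self_similar" and E :: "('v, 'e) pre_digraph" +
  assumes objects_eq_verts: "gobj G = verts E"
    and act_closed: "\<lbrakk>g \<in> garr G; e \<in> arcs E; gsrc G g = head E e\<rbrakk> \<Longrightarrow> act G g e \<in> arcs E"
    and head_act: "\<lbrakk>g \<in> garr G; e \<in> arcs E; gsrc G g = head E e\<rbrakk>
        \<Longrightarrow> head E (act G g e) = grng G g"
    and act_comp: "\<lbrakk>h \<in> garr G; g \<in> garr G; e \<in> arcs E; gsrc G h = grng G g; gsrc G g = head E e\<rbrakk>
        \<Longrightarrow> act G (gcomp G h g) e = act G h (act G g e)"
    and act_id: "e \<in> arcs E \<Longrightarrow> act G (gid G (head E e)) e = e"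
    and restr_closed: "\<lbrakk>g \<in> garr G; e \<in> arcs E; gsrc G g = head E e\<rbrakk> \<Longrightarrow> restr G g e \<in> garr G"
    and restr_comp: "\<lbrakk>h \<in> garr G; g \<in> garr G; e \<in> arcs E; gsrc G h = grng G g; gsrc G g = head E e\<rbrakk>
        \<Longrightarrow> restr G (gcomp G h g) e = gcomp G (restr G h (act G g e)) (restr G g e)"
    and src_restr: "\<lbrakk>g \<in> garr G; e \<in> arcs E; gsrc G g = head E e\<rbrakk>
        \<Longrightarrow> gsrc G (restr G g e) = tail E e"
    and rng_restr: "\<lbrakk>g \<in> garr G; e \<in> arcs E; gsrc G g = head E e\<rbrakk>
        \<Longrightarrow> grng G (restr G g e) = tail E (act G g e)"

primrec act_list :: "('v, 'g, 'e) self_similar \<Rightarrow> 'g \<Rightarrow> 'e list \<Rightarrow> 'e list" where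
  "act_list G g [] = []"
| "act_list G g (e # es) = act G g e # act_list G (restr G g e) es"

primrec restr_list :: "('v, 'g, 'e) self_similar \<Rightarrow> 'g \<Rightarrow> 'e list \<Rightarrow> 'g" where
  "restr_list G g [] = g"
| "restr_list G g (e # es) = restr_list G (restr G g e) es"

primcorec act_stream :: "('v, 'g, 'e) self_similar \<Rightarrow> 'g \<Rightarrow> 'e stream \<Rightarrow> 'e stream" where
  "act_stream G g t = act G g (shd t) ## act_stream G (restr G g (shd t)) (stl t)"

primrec act_path :: "('v, 'g, 'e) self_similar \<Rightarrow> 'g \<Rightarrow> ('v, 'e) epath \<Rightarrow> ('v, 'e) epath" where
  "act_path G g (FPath v es) = FPath (grng G g) (act_list G g es)"
| "act_path G g (IPath t) = IPath (act_stream G g t)"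

primrec restr_path :: "('v, 'g, 'e) self_similar \<Rightarrow> 'g \<Rightarrow> ('v, 'e) epath \<Rightarrow> 'g" where
  "restr_path G g (FPath v es) = restr_list G g es"
| "restr_path G g (IPath t) = undefined"

definition fixes_path ::
  "('v, 'g, 'e) self_similar \<Rightarrow> ('v, 'e) pre_digraph \<Rightarrow> 'g \<Rightarrow> ('v, 'e) epath \<Rightarrow> bool" where
  "fixes_path G E g \<mu> \<longleftrightarrow> \<mu> \<in> epaths_at E (gsrc G g) \<and> act_path G g \<mu> = \<mu>"

definition strongly_fixes ::
  "('v, 'g, 'e) self_similar \<Rightarrow> ('v, 'e) pre_digraph \<Rightarrow> 'g \<Rightarrow> ('v, 'e) epath \<Rightarrow> bool" where
  "strongly_fixes G E g \<mu> \<longleftrightarrow>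
     \<mu> \<in> fpaths_at E (gsrc G g) \<and> act_path G g \<mu> = \<mu> \<and> restr_path G g \<mu> = gid G (psource E \<mu>)"

definition G_cycle ::
  "('v, 'g, 'e) self_similar \<Rightarrow> ('v, 'e) pre_digraph \<Rightarrow> ('v, 'e) epath \<Rightarrow> bool" where
  "G_cycle G E \<alpha> \<longleftrightarrow> \<alpha> \<in> fpaths E \<and> plength \<alpha> \<noteq> 0 \<and>
     (\<exists>g \<in> garr G. gsrc G g = psource E \<alpha> \<and> grng G g = prange E \<alpha>)"

definition cond_Cyc :: "('v, 'g, 'e) self_similar \<Rightarrow> ('v, 'e) pre_digraph \<Rightarrow> bool" where
  "cond_Cyc G E \<longleftrightarrow> (\<forall>\<alpha>. G_cycle G E \<alpha> \<longrightarrow> has_entrance E \<alpha>)"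

definition cond_Evr :: "('v, 'g, 'e) self_similar \<Rightarrow> ('v, 'e) pre_digraph \<Rightarrow> bool" where
  "cond_Evr G E \<longleftrightarrow> (\<forall>g \<in> garr G.
     (\<forall>\<mu> \<in> fpaths_at E (gsrc G g). fixes_path G E g \<mu>) \<longrightarrow>
     (\<exists>\<mu> \<in> fpaths_at E (gsrc G g). strongly_fixes G E g \<mu>))"

definition cond_Rec :: "('v, 'g, 'e) self_similar \<Rightarrow> ('v, 'e) pre_digraph \<Rightarrow> bool" where
  "cond_Rec G E \<longleftrightarrow> (\<forall>g \<in> garr G. \<forall>\<alpha> \<in> fpaths E.
     fixes_path G E g \<alpha> \<and> finite_receiver E (psource E \<alpha>) \<longrightarrow> strongly_fixes G E g \<alpha>)"


section \<open>The groupoids of germs\<close>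

type_synonym ('v, 'g, 'e) germ_rep =
  "('v, 'e) epath \<times> 'g \<times> ('v, 'e) epath \<times> ('v, 'e) epath"

definition germ_reps ::
  "('v, 'g, 'e) self_similar \<Rightarrow> ('v, 'e) pre_digraph \<Rightarrow> ('v, 'g, 'e) germ_rep set" where
  "germ_reps G E = {(\<alpha>, g, \<beta>, \<xi>). \<alpha> \<in> fpaths E \<and> g \<in> garr G \<and> \<beta> \<in> fpaths E \<and>
     grng G g = psource E \<alpha> \<and> gsrc G g = psource E \<beta> \<and> \<xi> \<in> cylinder E \<beta>}"

definition germ_rel ::
  "('v, 'g, 'e) self_similar \<Rightarrow> ('v, 'e) pre_digraph \<Rightarrow> ('v, 'g, 'e) germ_rep rel" where
  "germ_rel G E = {((\<alpha>, g, \<beta>, \<xi>), (\<gamma>, h, \<delta>, \<eta>)).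
     (\<alpha>, g, \<beta>, \<xi>) \<in> germ_reps G E \<and> (\<gamma>, h, \<delta>, \<eta>) \<in> germ_reps G E \<and> \<xi> = \<eta> \<and>
     (\<exists>\<beta>' \<in> fpaths_at E (psource E \<beta>). \<exists>\<delta>' \<in> fpaths_at E (psource E \<delta>).
        pcat \<beta> \<beta>' = pcat \<delta> \<delta>' \<and> \<xi> \<in> cylinder E (pcat \<beta> \<beta>') \<and>
        pcat \<alpha> (act_path G g \<beta>') = pcat \<gamma> (act_path G h \<delta>') \<and>
        restr_path G g \<beta>' = restr_path G h \<delta>')}"

definition germ :: "('v, 'g, 'e) self_similar \<Rightarrow> ('v, 'e) pre_digraph \<Rightarrow>
    ('v, 'e) epath \<Rightarrow> 'g \<Rightarrow> ('v, 'e) epath \<Rightarrow> ('v, 'e) epath \<Rightarrow> ('v, 'g, 'e) germ_rep set" where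
  "germ G E \<alpha> g \<beta> \<xi> = germ_rel G E `` {(\<alpha>, g, \<beta>, \<xi>)}"

definition germ_source :: "('v, 'g, 'e) germ_rep set \<Rightarrow> ('v, 'e) epath" where
  "germ_source c = (THE \<xi>. \<exists>\<alpha> g \<beta>. (\<alpha>, g, \<beta>, \<xi>) \<in> c)"

definition germ_range :: "('v, 'g, 'e) self_similar \<Rightarrow> ('v, 'e) pre_digraph \<Rightarrow>
    ('v, 'g, 'e) germ_rep set \<Rightarrow> ('v, 'e) epath" where
  "germ_range G E c = (THE \<zeta>. \<exists>\<alpha> g \<beta>. \<exists>\<xi> \<in> epaths_at E (psource E \<beta>).
     (\<alpha>, g, \<beta>, pcat \<beta> \<xi>) \<in> c \<and> \<zeta> = pcat \<alpha> (act_path G g \<xi>))"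

definition germ_unit :: "('v, 'g, 'e) self_similar \<Rightarrow> ('v, 'e) pre_digraph \<Rightarrow>
    ('v, 'e) epath \<Rightarrow> ('v, 'g, 'e) germ_rep set" where
  "germ_unit G E \<xi> =
     (let v = prange E \<xi> in germ G E (FPath v []) (gid G v) (FPath v []) \<xi>)"

text \<open>
  \<open>triple_prod G E s t u\<close> states that \<open>u\<close> is the product \<open>s t\<close> of the triples \<open>s\<close> and \<open>t\<close>.
  If the range of \<open>[t; \<eta>]\<close> is the source of \<open>[s; \<xi>]\<close>, one of the two cases applies.
\<close>

inductive triple_prod :: "('v, 'g, 'e) self_similar \<Rightarrow> ('v, 'e) pre_digraph \<Rightarrow>
    ('v, 'e) epath \<times> 'g \<times> ('v, 'e) epath \<Rightarrow> ('v, 'e) epath \<times> 'g \<times> ('v, 'e) epath \<Rightarrow>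
    ('v, 'e) epath \<times> 'g \<times> ('v, 'e) epath \<Rightarrow> bool"
  for G :: "('v, 'g, 'e) self_similar" and E :: "('v, 'e) pre_digraph" where
  right_longer: "\<beta>' \<in> fpaths_at E (psource E \<beta>) \<Longrightarrow>
    triple_prod G E (\<alpha>, g, \<beta>) (pcat \<beta> \<beta>', h, \<delta>)
      (pcat \<alpha> (act_path G g \<beta>'), gcomp G (restr_path G g \<beta>') h, \<delta>)"
| left_longer: "\<gamma>' \<in> fpaths_at E (psource E \<gamma>) \<Longrightarrow>
    triple_prod G E (\<alpha>, g, pcat \<gamma> \<gamma>') (\<gamma>, h, \<delta>)
      (\<alpha>, gcomp G g (ginv G (restr_path G (ginv G h) \<gamma>')),
       pcat \<delta> (act_path G (ginv G h) \<gamma>'))"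

definition germ_comp :: "('v, 'g, 'e) self_similar \<Rightarrow> ('v, 'e) pre_digraph \<Rightarrow>
    ('v, 'g, 'e) germ_rep set \<Rightarrow> ('v, 'g, 'e) germ_rep set \<Rightarrow> ('v, 'g, 'e) germ_rep set" where
  "germ_comp G E c d = (THE x. \<exists>\<alpha> g \<beta> \<xi> \<gamma> h \<delta> \<eta> \<epsilon> k \<theta>.
     (\<alpha>, g, \<beta>, \<xi>) \<in> c \<and> (\<gamma>, h, \<delta>, \<eta>) \<in> d \<and>
     triple_prod G E (\<alpha>, g, \<beta>) (\<gamma>, h, \<delta>) (\<epsilon>, k, \<theta>) \<and> x = germ G E \<epsilon> k \<theta> \<eta>)"

definition germ_topology :: "('v, 'g, 'e) self_similar \<Rightarrow> ('v, 'e) pre_digraph \<Rightarrow>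
    ('v, 'g, 'e) germ_rep set topology" where
  "germ_topology G E = topology_generated_by
     {{germ G E \<alpha> g \<beta> \<xi> |\<xi>. \<xi> \<in> V} |\<alpha> g \<beta> V.
        \<alpha> \<in> fpaths E \<and> g \<in> garr G \<and> \<beta> \<in> fpaths E \<and>
        grng G g = psource E \<alpha> \<and> gsrc G g = psource E \<beta> \<and>
        openin (path_topology E) V \<and> V \<subseteq> cylinder E \<beta>}"

text \<open>
  \<open>\<dots>_tilde\<close> are the groupoids with unit space \<open>epaths E\<close>, and \<open>tight_groupoid\<dots>\<close>
  their restrictions to the boundary paths.
\<close>

definition groupoid_tilde :: "('v, 'g, 'e) self_similar \<Rightarrow> ('v, 'e) pre_digraph \<Rightarrow>
    (('v, 'e) epath, ('v, 'g, 'e) germ_rep set) top_groupoid" where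
  "groupoid_tilde G E =
     \<lparr>gobj = epaths E, garr = germ_reps G E // germ_rel G E,
      gsrc = germ_source, grng = germ_range G E, gid = germ_unit G E,
      gcomp = germ_comp G E, gtop = germ_topology G E\<rparr>"

definition tight_groupoid :: "('v, 'g, 'e) self_similar \<Rightarrow> ('v, 'e) pre_digraph \<Rightarrow>
    (('v, 'e) epath, ('v, 'g, 'e) germ_rep set) top_groupoid" where
  "tight_groupoid G E = restrict_objects (groupoid_tilde G E) (boundary_paths E)"

definition germs0 ::
  "('v, 'g, 'e) self_similar \<Rightarrow> ('v, 'e) pre_digraph \<Rightarrow> ('v, 'g, 'e) germ_rep set set" where
  "germs0 G E = {germ G E \<alpha> g \<beta> \<xi> |\<alpha> g \<beta> \<xi>.
     (\<alpha>, g, \<beta>, \<xi>) \<in> germ_reps G E \<and> plength \<alpha> = plength \<beta>}"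

definition germs00 ::
  "('v, 'g, 'e) self_similar \<Rightarrow> ('v, 'e) pre_digraph \<Rightarrow> ('v, 'g, 'e) germ_rep set set" where
  "germs00 G E = {germ G E (act_path G g \<beta>) (restr_path G g \<beta>) \<beta> (pcat \<beta> \<xi>) |g \<beta> \<xi>.
     g \<in> garr G \<and> \<beta> \<in> fpaths E \<and> gsrc G g = prange E \<beta> \<and> \<xi> \<in> epaths_at E (psource E \<beta>)}"

definition groupoid0_tilde :: "('v, 'g, 'e) self_similar \<Rightarrow> ('v, 'e) pre_digraph \<Rightarrow>
    (('v, 'e) epath, ('v, 'g, 'e) germ_rep set) top_groupoid" where
  "groupoid0_tilde G E = restrict_arrows (groupoid_tilde G E) (germs0 G E)"

definition groupoid00_tilde :: "('v, 'g, 'e) self_similar \<Rightarrow> ('v, 'e) pre_digraph \<Rightarrow>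
    (('v, 'e) epath, ('v, 'g, 'e) germ_rep set) top_groupoid" where
  "groupoid00_tilde G E = restrict_arrows (groupoid_tilde G E) (germs00 G E)"

definition tight_groupoid0 :: "('v, 'g, 'e) self_similar \<Rightarrow> ('v, 'e) pre_digraph \<Rightarrow>
    (('v, 'e) epath, ('v, 'g, 'e) germ_rep set) top_groupoid" where
  "tight_groupoid0 G E = restrict_arrows (tight_groupoid G E) (germs0 G E)"

definition tight_groupoid00 :: "('v, 'g, 'e) self_similar \<Rightarrow> ('v, 'e) pre_digraph \<Rightarrow>
    (('v, 'e) epath, ('v, 'g, 'e) germ_rep set) top_groupoid" where
  "tight_groupoid00 G E = restrict_arrows (tight_groupoid G E) (germs00 G E)"

end

theory Submission
  imports Defs "HOL-Library.Sublist"
begin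

text \<open>
  A groupoid of germs fails to be topologically free iff, for some \<open>(\<alpha>, g, \<beta>)\<close> and some open
  \<open>V \<subseteq> Z(\<beta>)\<close> meeting the unit space, all germs \<open>[\<alpha>, g, \<beta>; \<xi>]\<close> with \<open>\<xi> \<in> V\<close> are isotropy but not
  units. At a boundary point \<open>V\<close> contains a whole cylinder \<open>Z(\<lambda>)\<close>. If \<open>|\<alpha>| = |\<beta>|\<close>, this forces
  \<open>\<alpha> = \<beta>\<close>, and a restriction of \<open>g\<close> fixes every path at \<open>s(\<lambda>)\<close>, so (Evr) yields a unit. If
  \<open>|\<alpha>| \<noteq> |\<beta>|\<close>, then some \<open>h \<in> G\<close> satisfies \<open>h\<zeta> = \<nu>\<zeta>\<close> for all boundary paths \<open>\<zeta>\<close> at \<open>s(h)\<close>, which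
  makes \<open>\<nu>\<close> a \<open>G\<close>-cycle without entrance. The points outside the boundary are finite paths
  ending in a finite receiver; they are isolated and governed by (Rec). Conversely, a violation of
  (Evr), (Rec) or (Cyc) exhibits such a triple and \<open>V\<close> directly; for (Cyc), the set of boundary
  points in \<open>V\<close> is a single path.
\<close>

section \<open>Paths as lists of edges\<close>

text \<open>The statement mixes finite and infinite paths, and germs are equivalence classes whose
  source and range are definite descriptions. Both difficulties are met by working with finite
  prefixes: a path is determined by its range and its prefixes, and equality of two germs at \<xi>
  is witnessed on one prefix of \<xi>, hence holds on the whole cylinder of that prefix. This is
  what allows one triple to be held fixed while \<xi> varies. (Cyc) is missing from (3) because
  every nonempty open set of paths contains a finite path, and once finite paths are units, counting
  edges there rules out |\<alpha>| \<noteq> |\<beta>|. (Rec) is missing from (1) and (2) because a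
  path ending in a vertex that receives finitely many, but some, edges is not a boundary path. A
  vertex receiving no edge is both singular and a finite receiver; there (Evr) already gives what
  (Rec) demands.\<close>

primrec walk :: "('v, 'e) pre_digraph \<Rightarrow> 'v \<Rightarrow> 'e list \<Rightarrow> bool" where
  "walk E v [] \<longleftrightarrow> v \<in> verts E"
| "walk E v (e # es) \<longleftrightarrow> e \<in> edges_at E v \<and> walk E (tail E e) es"

primrec walk_source :: "('v, 'e) pre_digraph \<Rightarrow> 'v \<Rightarrow> 'e list \<Rightarrow> 'v" where
  "walk_source E v [] = v"
| "walk_source E v (e # es) = walk_source E (tail E e) es"

text \<open>Comparing paths only through their finite prefixes treats both constructors alike.
  Prefixes are bare edge lists, so the range of a path is always recorded separately.\<close>

primrec is_prefix :: "'e list \<Rightarrow> ('v, 'e) epath \<Rightarrow> bool" where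
  "is_prefix es (FPath v fs) \<longleftrightarrow> prefix es fs"
| "is_prefix es (IPath t) \<longleftrightarrow> stake (length es) t = es"

lemma psource_FPath [simp]: "psource E (FPath v es) = walk_source E v es"
proof -
  have "walk_source E v es = (if es = [] then v else tail E (last es))" for v es
    by (induction es arbitrary: v) auto
  then show ?thesis by simp
qed

declare psource.simps(1) [simp del]

lemma walk_source_append [simp]:
  "walk_source E v (es @ fs) = walk_source E (walk_source E v es) fs"
  by (induction es arbitrary: v) auto

lemma is_prefix_Nil [simp]: "is_prefix [] \<xi>"
  by (cases \<xi>) auto

lemma is_prefix_append_left: "is_prefix (es @ fs) \<xi> \<Longrightarrow> is_prefix es \<xi>"
proof (cases \<xi>)
  case (IPath t)
  assume "is_prefix (es @ fs) \<xi>"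
  then have "take (length es) (stake (length es + length fs) t) = take (length es) (es @ fs)"
    using IPath by simp
  then show ?thesis using IPath by (simp add: take_stake)
qed (auto simp: prefix_def)

lemma is_prefix_prefix: "is_prefix fs \<xi> \<Longrightarrow> prefix es fs \<Longrightarrow> is_prefix es \<xi>"
  by (auto simp: prefix_def intro: is_prefix_append_left)

lemma is_prefix_linear:
  assumes "is_prefix es \<xi>" "is_prefix fs \<xi>" "length es \<le> length fs"
  shows "prefix es fs"
proof (cases \<xi>)
  case (FPath v xs)
  then show ?thesis using assms by (auto intro: prefix_length_prefix)
next
  case (IPath t)
  then have "es = take (length es) fs"
    using assms take_stake[of "length es" "length fs" t] by simp
  then show ?thesis by (metis take_is_prefix)
qed

lemma is_prefix_cases:
  assumes "is_prefix es \<xi>" "is_prefix fs \<xi>"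
  shows "(\<exists>xs. fs = es @ xs) \<or> (\<exists>xs. es = fs @ xs)"
  using is_prefix_linear[OF assms] is_prefix_linear[OF assms(2,1)] nat_le_linear
  by (auto simp: prefix_def)

lemma is_prefix_pcat:
  "is_prefix es (pcat (FPath v fs) \<zeta>) \<longleftrightarrow> prefix es fs \<or> (\<exists>es'. es = fs @ es' \<and> is_prefix es' \<zeta>)"
proof (cases \<zeta>)
  case (FPath w xs)
  then show ?thesis by (auto simp: prefix_append)
next
  case (IPath t)
  show ?thesis
  proof (cases "length es \<le> length fs")
    case True
    then have "stake (length es) (fs @- t) = take (length es) fs"
      by (simp add: stake_shift)
    then show ?thesis using IPath True
      by (auto simp: prefix_def) (metis append_take_drop_id)+
  next
    case False
    then have "stake (length es) (fs @- t) = fs @ stake (length es - length fs) t"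
      by (simp add: stake_shift)
    then show ?thesis using IPath False
      by (auto simp: prefix_def)
        (metis add_diff_cancel_left' length_append length_stake)+
  qed
qed

lemma is_prefix_append_pcat [simp]:
  "is_prefix (fs @ es) (pcat (FPath v fs) \<zeta>) \<longleftrightarrow> is_prefix es \<zeta>"
  by (auto simp: is_prefix_pcat prefix_def)

lemma is_prefix_self_pcat [simp]: "is_prefix fs (pcat (FPath v fs) \<zeta>)"
  by (simp add: is_prefix_pcat)

text \<open>The first premise is there because the prefixes of a path of length zero do not reveal
  its vertex. A finite path with n edges is told apart from an infinite one by a prefix of length n
  + 1.\<close>

lemma epath_eqI:
  assumes "prange E \<xi> = prange E \<zeta>" "\<And>es. is_prefix es \<xi> \<longleftrightarrow> is_prefix es \<zeta>"
  shows "\<xi> = \<zeta>"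
proof (cases \<xi>; cases \<zeta>)
  fix v es w fs assume "\<xi> = FPath v es" "\<zeta> = FPath w fs"
  then show ?thesis using assms assms(2)[of es] assms(2)[of fs] by (auto intro: prefix_order.antisym)
next
  fix v es t assume h: "\<xi> = FPath v es" "\<zeta> = IPath t"
  then show ?thesis using assms(2)[of "stake (Suc (length es)) t"]
    by (auto simp del: stake.simps dest: prefix_length_le)
next
  fix v es t assume h: "\<zeta> = FPath v es" "\<xi> = IPath t"
  then show ?thesis using assms(2)[of "stake (Suc (length es)) t"]
    by (auto simp del: stake.simps dest: prefix_length_le)
next
  fix s t assume h: "\<xi> = IPath s" "\<zeta> = IPath t"
  then have "stake n s = stake n t" for n
    using assms(2)[of "stake n s"] by simp
  then have "s !! n = t !! n" for n
    using stake_nth[of n "Suc n" s] stake_nth[of n "Suc n" t] by (simp del: stake.simps)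
  then have "(!!) s = (!!) t" by blast
  then show ?thesis using h by (metis stream_smap_nats)
qed

lemma ex_is_prefix_of_length:
  "\<exists>t. \<xi> = IPath t \<Longrightarrow> \<exists>es. length es = n \<and> is_prefix es \<xi>"
  by (auto intro: exI[of _ "stake n _"])

text \<open>The vertex \<open>w\<close> is arbitrary because \<open>pcat\<close> forgets the range
  stored in its second argument. For the same reason cancellation below has to assume equal
  ranges.\<close>

lemma pcat_assoc:
  "pcat (FPath v (es @ fs)) \<zeta> = pcat (FPath v es) (pcat (FPath w fs) \<zeta>)"
  by (cases \<zeta>) auto

lemma pcat_left_cancel:
  assumes "pcat (FPath v es) \<xi> = pcat (FPath v es) \<zeta>" "prange E \<xi> = prange E \<zeta>"
  shows "\<xi> = \<zeta>"
  using assms(2)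
proof (rule epath_eqI)
  show "is_prefix fs \<xi> \<longleftrightarrow> is_prefix fs \<zeta>" for fs
    using assms(1) is_prefix_append_pcat[of es fs v] by metis
qed

section \<open>Paths and cylinders of a graph in terms of walks\<close>

context wf_digraph
begin

lemma edges_atD: "e \<in> edges_at G v \<Longrightarrow> e \<in> arcs G \<and> head G e = v \<and> tail G e \<in> verts G \<and> v \<in> verts G"
  by (auto simp: edges_at_def)

lemma walk_range: "walk G v es \<Longrightarrow> v \<in> verts G"
  by (cases es) (auto dest: edges_atD)

lemma walk_source_verts: "walk G v es \<Longrightarrow> walk_source G v es \<in> verts G"
  by (induction es arbitrary: v) auto

lemma walk_append [simp]:
  "walk G v (es @ fs) \<longleftrightarrow> walk G v es \<and> walk G (walk_source G v es) fs"
  by (induction es arbitrary: v) (auto dest: walk_range)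

lemma fpaths_iff [simp]: "FPath v es \<in> fpaths G \<longleftrightarrow> walk G v es"
proof -
  have "walk G v es \<longleftrightarrow> v \<in> verts G \<and> set es \<subseteq> arcs G \<and>
     (\<forall>i. Suc i < length es \<longrightarrow> tail G (es ! i) = head G (es ! Suc i)) \<and>
     (es \<noteq> [] \<longrightarrow> v = head G (hd es))" for v
  proof (induction es arbitrary: v)
    case (Cons e es)
    have "(\<forall>i. Suc i < length (e # es) \<longrightarrow> tail G ((e # es) ! i) = head G ((e # es) ! Suc i)) \<longleftrightarrow>
       (es \<noteq> [] \<longrightarrow> tail G e = head G (hd es)) \<and>
       (\<forall>i. Suc i < length es \<longrightarrow> tail G (es ! i) = head G (es ! Suc i))"
      by (cases es) (auto simp: nth_Cons split: nat.splits)
    then show ?case using Cons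
      by (cases "es = []") (auto simp: edges_at_def, metis tail_in_verts)
  qed simp
  then show ?thesis by (auto simp: fpaths_def)
qed

lemma IPath_notin_fpaths [simp]: "IPath t \<notin> fpaths G"
  by (auto simp: fpaths_def)

lemma FPath_notin_ipaths [simp]: "FPath v es \<notin> ipaths G"
  by (auto simp: ipaths_def)

lemma ipaths_iff_walk_stake: "IPath t \<in> ipaths G \<longleftrightarrow> (\<forall>n. walk G (head G (shd t)) (stake n t))"
proof
  assume t: "IPath t \<in> ipaths G"
  show "\<forall>n. walk G (head G (shd t)) (stake n t)"
  proof
    fix n show "walk G (head G (shd t)) (stake n t)" using t
    proof (induction n arbitrary: t)
      case 0
      then have "t !! 0 \<in> arcs G" by (auto simp only: ipaths_def)
      then show ?case by simp
    next
      case (Suc n)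
      have s: "t !! i \<in> arcs G" "tail G (t !! i) = head G (t !! Suc i)" for i
        using Suc.prems by (auto simp: ipaths_def)
      have "IPath (stl t) \<in> ipaths G" using s[of "Suc _"] by (auto simp: ipaths_def)
      from Suc.IH[OF this] show ?case using s[of 0] by (simp add: edges_at_def)
    qed
  qed
next
  assume w: "\<forall>n. walk G (head G (shd t)) (stake n t)"
  have "t !! i \<in> arcs G \<and> tail G (t !! i) = head G (t !! Suc i)" for i
  proof -
    \<comment> \<open>Composability of edges i and i + 1 becomes visible in the prefix of length i +
      2.\<close>
    have "walk G (head G (shd t)) (stake i t @ [t !! i, t !! Suc i])"
      using w[rule_format, of "Suc (Suc i)"] by (simp del: stake.simps add: stake_Suc)
    then show ?thesis by (auto simp: edges_at_def)
  qed
  then show "IPath t \<in> ipaths G" by (auto simp: ipaths_def)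
qed

text \<open>Composability concerns two neighbouring edges at a time, so finite prefixes detect it; a
  finite path is even a prefix of itself. Membership of concatenations and of images under the
  action thus reduces to facts about prefixes.\<close>

lemma epaths_iff: "\<xi> \<in> epaths G \<longleftrightarrow> (\<forall>es. is_prefix es \<xi> \<longrightarrow> walk G (prange G \<xi>) es)"
proof (cases \<xi>)
  case (FPath v fs)
  then show ?thesis by (auto simp: epaths_def prefix_def)
next
  case (IPath t)
  then show ?thesis using ipaths_iff_walk_stake[of t]
    by (auto simp: epaths_def) (metis length_stake)
qed

lemma epaths_FPath [simp]: "FPath v es \<in> epaths G \<longleftrightarrow> walk G v es"
  by (simp add: epaths_def)

lemma epaths_at_iff: "\<xi> \<in> epaths_at G v \<longleftrightarrow> prange G \<xi> = v \<and> (\<forall>es. is_prefix es \<xi> \<longrightarrow> walk G v es)"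
  by (auto simp: epaths_at_def epaths_iff)

lemma epaths_at_self: "\<xi> \<in> epaths G \<Longrightarrow> \<xi> \<in> epaths_at G (prange G \<xi>)"
  by (simp add: epaths_at_def)

lemma prange_pcat:
  assumes "walk G v es" "prange G \<zeta> = walk_source G v es"
  shows "prange G (pcat (FPath v es) \<zeta>) = v"
  using assms by (cases \<zeta>; cases es) (auto dest: edges_atD)

lemma pcat_epaths_at:
  assumes "walk G v es" "\<zeta> \<in> epaths_at G (walk_source G v es)"
  shows "pcat (FPath v es) \<zeta> \<in> epaths_at G v"
  using assms by (auto simp: epaths_at_iff prange_pcat is_prefix_pcat prefix_def)

lemma is_prefix_split:
  assumes "\<xi> \<in> epaths_at G v" "is_prefix es \<xi>"
  obtains \<zeta> where "\<zeta> \<in> epaths_at G (walk_source G v es)" "\<xi> = pcat (FPath v es) \<zeta>"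
proof -
  have w: "walk G v es" using assms by (simp add: epaths_at_iff)
  have "\<exists>\<zeta>. prange G \<zeta> = walk_source G v es \<and> \<xi> = pcat (FPath v es) \<zeta>"
  proof (cases \<xi>)
    case (FPath u xs)
    then obtain ys where "xs = es @ ys" "u = v" using assms by (auto simp: prefix_def epaths_at_def)
    then show ?thesis using FPath by (intro exI[of _ "FPath (walk_source G v es) ys"]) auto
  next
    case (IPath t)
    \<comment> \<open>One edge beyond \<open>es\<close> is inspected, since the range of the
      remaining stream is read off from its first edge.\<close>
    have "walk G v (stake (Suc (length es)) t)"
      using assms(1) IPath by (auto simp: epaths_at_iff simp del: stake.simps)
    then have "walk G v (es @ [t !! length es])"
      using assms(2) IPath by (simp del: stake.simps add: stake_Suc)
    then show ?thesis using IPath assms(2)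
      by (intro exI[of _ "IPath (sdrop (length es) t)"])
        (auto dest: edges_atD, metis stake_sdrop)
  qed
  then obtain \<zeta> where z: "prange G \<zeta> = walk_source G v es" "\<xi> = pcat (FPath v es) \<zeta>" by blast
  moreover have "walk G (walk_source G v es) fs" if "is_prefix fs \<zeta>" for fs
  proof -
    have "is_prefix (es @ fs) \<xi>" using that z by simp
    then have "walk G v (es @ fs)" using assms by (simp only: epaths_at_iff)
    then show ?thesis by simp
  qed
  ultimately show ?thesis using that by (auto simp: epaths_at_iff)
qed

lemma cylinder_iff:
  assumes "walk G v es"
  shows "\<xi> \<in> cylinder G (FPath v es) \<longleftrightarrow> \<xi> \<in> epaths_at G v \<and> is_prefix es \<xi>"
  using pcat_epaths_at[OF assms] is_prefix_split[of \<xi> v es]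
  by (auto simp: cylinder_def)

lemma fpaths_at_iff: "\<mu> \<in> fpaths_at G v \<longleftrightarrow> (\<exists>es. \<mu> = FPath v es \<and> walk G v es)"
  by (cases \<mu>) (auto simp: fpaths_at_def)

lemma fpathsE:
  assumes "\<mu> \<in> fpaths G"
  obtains v es where "\<mu> = FPath v es" "walk G v es"
  using assms by (cases \<mu>) auto

end

section \<open>The action on paths\<close>

lemma length_act_list [simp]: "length (act_list G g es) = length es"
  by (induction es arbitrary: g) auto

lemma act_list_append [simp]:
  "act_list G g (es @ fs) = act_list G g es @ act_list G (restr_list G g es) fs"
  by (induction es arbitrary: g) auto

lemma restr_list_append [simp]:
  "restr_list G g (es @ fs) = restr_list G (restr_list G g es) fs"
  by (induction es arbitrary: g) auto

lemma stake_act_stream: "stake n (act_stream G g t) = act_list G g (stake n t)"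
  by (induction n arbitrary: g t) auto

text \<open>The action preserves length, so cutting the image after \<open>fs\<close> cuts
  \<open>es\<close> at the same position.\<close>

lemma act_list_eq_append:
  assumes "act_list G g es = fs @ fs'"
  obtains xs ys where "es = xs @ ys" "fs = act_list G g xs" "fs' = act_list G (restr_list G g xs) ys"
proof
  have "act_list G g (take (length fs) es) @ act_list G (restr_list G g (take (length fs) es))
      (drop (length fs) es) = fs @ fs'"
    using assms by (metis act_list_append append_take_drop_id)
  moreover have "length (take (length fs) es) = length fs"
    using arg_cong[OF assms, of length] by simp
  ultimately show "fs = act_list G g (take (length fs) es)"
    "fs' = act_list G (restr_list G g (take (length fs) es)) (drop (length fs) es)"
    by (simp_all add: append_eq_append_conv)
qed simp

text \<open>The first n edges of g\<xi> depend only on the first n edges of \<xi>.\<close>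

lemma is_prefix_act_path: "is_prefix es (act_path G g \<xi>) \<longleftrightarrow> (\<exists>fs. is_prefix fs \<xi> \<and> es = act_list G g fs)"
proof (cases \<xi>)
  case (FPath v xs)
  then show ?thesis
    by (auto simp: prefix_def elim!: act_list_eq_append)
next
  case (IPath t)
  then show ?thesis
    by (auto simp: stake_act_stream intro!: exI[of _ "stake (length es) t"])
qed

lemma is_prefix_act_path_act_list: "is_prefix es \<xi> \<Longrightarrow> is_prefix (act_list G g es) (act_path G g \<xi>)"
  by (auto simp: is_prefix_act_path)

lemma act_path_pcat:
  "act_path G g (pcat (FPath v es) \<zeta>) =
     pcat (FPath (grng G g) (act_list G g es)) (act_path G (restr_list G g es) \<zeta>)"
proof -
  have "act_stream G g (e ## t) = act G g e ## act_stream G (restr G g e) t" for g e t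
    by (subst act_stream.code) simp
  then have "act_stream G g (es @- t) = act_list G g es @- act_stream G (restr_list G g es) t" for t
    by (induction es arbitrary: g) simp_all
  then show ?thesis by (cases \<zeta>) auto
qed

section \<open>Units and inverses, and their action on walks and paths\<close>

context groupoid
begin

lemma idempotent_eq_id:
  assumes "k \<in> garr G" "gsrc G k = grng G k" "gcomp G k k = k"
  shows "k = gid G (gsrc G k)"
proof -
  obtain h where h: "is_inverse G k h" using ex_inverse assms by blast
  then have "gcomp G h (gcomp G k k) = gcomp G (gcomp G h k) k"
    using assms by (subst comp_assoc) (auto simp: is_inverse_def)
  then show ?thesis using h assms comp_id_left[OF assms(1)] by (auto simp: is_inverse_def)
qed

lemma inverseE:
  assumes "g \<in> garr G"
  obtains h where "h \<in> garr G" "gsrc G h = grng G g" "grng G h = gsrc G g"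
    "gcomp G h g = gid G (gsrc G g)" "gcomp G g h = gid G (grng G g)"
  using ex_inverse[OF assms] by (auto simp: is_inverse_def)

end

context self_similar_action
begin

text \<open>The axioms do not say that units restrict to units. A unit is idempotent, the rule for
  restricting products makes its restriction idempotent, and an idempotent of a groupoid is a
  unit.\<close>

lemma restr_id:
  assumes "e \<in> edges_at E v" shows "restr G (gid G v) e = gid G (tail E e)"
proof -
  have e: "e \<in> arcs E" "head E e = v" "v \<in> gobj G"
    using edges_atD[OF assms] objects_eq_verts by auto
  note i = id_closed[OF e(3)] src_id[OF e(3)] rng_id[OF e(3)]
  have ae: "act G (gid G v) e = e" using act_id e by blast
  have "gcomp G (gid G v) (gid G v) = gid G v" using comp_id_left[OF i(1)] i by simp
  then have "gcomp G (restr G (gid G v) e) (restr G (gid G v) e) = restr G (gid G v) e"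
    using restr_comp[OF i(1) i(1) e(1)] ae i e by simp
  from idempotent_eq_id[OF _ _ this] show ?thesis
    using restr_closed[of "gid G v" e] src_restr[of "gid G v" e] rng_restr[of "gid G v" e] i e ae by simp
qed

lemma act_edges_at:
  assumes "g \<in> garr G" "e \<in> edges_at E (gsrc G g)"
  shows "act G g e \<in> edges_at E (grng G g)" "restr G g e \<in> garr G"
    "gsrc G (restr G g e) = tail E e" "grng G (restr G g e) = tail E (act G g e)"
  using assms act_closed head_act restr_closed src_restr rng_restr by (auto simp: edges_at_def)

lemma act_list_closed:
  assumes "g \<in> garr G" "walk E (gsrc G g) es"
  shows "walk E (grng G g) (act_list G g es)" "restr_list G g es \<in> garr G"
    "gsrc G (restr_list G g es) = walk_source E (gsrc G g) es"
    "grng G (restr_list G g es) = walk_source E (grng G g) (act_list G g es)"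
proof -
  have "walk E (grng G g) (act_list G g es) \<and> restr_list G g es \<in> garr G \<and>
    gsrc G (restr_list G g es) = walk_source E (gsrc G g) es \<and>
    grng G (restr_list G g es) = walk_source E (grng G g) (act_list G g es)"
    using assms
  proof (induction es arbitrary: g)
    case Nil
    then show ?case using rng_closed objects_eq_verts by simp
  next
    case (Cons e es)
    then show ?case using act_edges_at[of g e] Cons.IH[of "restr G g e"] by simp
  qed
  then show "walk E (grng G g) (act_list G g es)" "restr_list G g es \<in> garr G"
    "gsrc G (restr_list G g es) = walk_source E (gsrc G g) es"
    "grng G (restr_list G g es) = walk_source E (grng G g) (act_list G g es)" by auto
qed

lemma gid_closed:
  assumes "v \<in> verts E" shows "gid G v \<in> garr G" "gsrc G (gid G v) = v" "grng G (gid G v) = v"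
  using assms id_closed src_id rng_id objects_eq_verts by auto

lemma act_list_id:
  assumes "walk E v es"
  shows "act_list G (gid G v) es = es" "restr_list G (gid G v) es = gid G (walk_source E v es)"
proof -
  have "act_list G (gid G v) es = es \<and> restr_list G (gid G v) es = gid G (walk_source E v es)"
    using assms
  proof (induction es arbitrary: v)
    case (Cons e es)
    then have "act G (gid G v) e = e" "restr G (gid G v) e = gid G (tail E e)"
      using act_id restr_id by (auto simp: edges_at_def)
    then show ?case using Cons by auto
  qed simp
  then show "act_list G (gid G v) es = es"
    "restr_list G (gid G v) es = gid G (walk_source E v es)" by auto
qed

lemma act_list_comp:
  assumes "h \<in> garr G" "g \<in> garr G" "gsrc G h = grng G g" "walk E (gsrc G g) es"
  shows "act_list G (gcomp G h g) es = act_list G h (act_list G g es)"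
  using assms
proof (induction es arbitrary: g h)
  case (Cons e es)
  then have e: "e \<in> arcs E" "gsrc G g = head E e" "e \<in> edges_at E (gsrc G g)"
    by (auto simp: edges_at_def)
  have "act G g e \<in> edges_at E (gsrc G h)" using act_edges_at(1)[of g e] e Cons.prems by simp
  then show ?case using Cons.prems e act_comp[of h g e] restr_comp[of h g e]
      Cons.IH[of "restr G h (act G g e)" "restr G g e"] act_edges_at[of g e]
      act_edges_at[of h "act G g e"] by simp
qed simp

lemma act_list_inverse:
  assumes "g \<in> garr G" "h \<in> garr G" "gsrc G h = grng G g" "gcomp G h g = gid G (gsrc G g)"
    "walk E (gsrc G g) es"
  shows "act_list G h (act_list G g es) = es"
  using act_list_comp[of h g es] assms act_list_id[of "gsrc G g" es] by simp

lemma act_list_inj: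
  assumes "g \<in> garr G" "walk E (gsrc G g) es" "walk E (gsrc G g) fs"
    "act_list G g es = act_list G g fs"
  shows "es = fs"
  using inverseE[OF assms(1)] act_list_inverse assms by metis

lemma prange_act_path:
  assumes "g \<in> garr G" "\<xi> \<in> epaths_at E (gsrc G g)"
  shows "prange E (act_path G g \<xi>) = grng G g"
proof (cases \<xi>)
  case (IPath t)
  then have "is_prefix [shd t] \<xi>" by simp
  then have "walk E (gsrc G g) [shd t]" using assms(2) by (simp only: epaths_at_iff)
  then have "shd t \<in> edges_at E (gsrc G g)" by simp
  then show ?thesis using act_edges_at(1)[OF assms(1)] IPath by (auto simp: edges_at_def)
qed auto

lemma act_path_epaths_at:
  assumes "g \<in> garr G" "\<xi> \<in> epaths_at E (gsrc G g)"
  shows "act_path G g \<xi> \<in> epaths_at E (grng G g)"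
  using assms act_list_closed(1)[OF assms(1)] prange_act_path[OF assms]
  by (auto simp: epaths_at_iff is_prefix_act_path)

lemma act_path_inverse:
  assumes "g \<in> garr G" "h \<in> garr G" "gsrc G h = grng G g" "gcomp G h g = gid G (gsrc G g)"
    "grng G h = gsrc G g" "\<xi> \<in> epaths_at E (gsrc G g)"
  shows "act_path G h (act_path G g \<xi>) = \<xi>"
proof (rule epath_eqI[of E])
  have p: "act_path G g \<xi> \<in> epaths_at E (gsrc G h)" using act_path_epaths_at assms by simp
  show "prange E (act_path G h (act_path G g \<xi>)) = prange E \<xi>"
    using prange_act_path[OF assms(2) p] assms by (simp add: epaths_at_iff)
  show "is_prefix es (act_path G h (act_path G g \<xi>)) \<longleftrightarrow> is_prefix es \<xi>" for es
    using assms act_list_inverse[OF assms(1-4)] by (auto simp: is_prefix_act_path epaths_at_iff)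
qed

section \<open>Boundary paths\<close>

lemma boundary_iff: "\<xi> \<in> boundary_paths E \<longleftrightarrow>
    \<xi> \<in> epaths E \<and> (\<forall>v es. \<xi> = FPath v es \<longrightarrow> singular E (walk_source E v es))"
  by (cases \<xi>) (auto simp: boundary_paths_def epaths_def)

lemma boundary_epaths: "\<xi> \<in> boundary_paths E \<Longrightarrow> \<xi> \<in> epaths E"
  by (simp add: boundary_iff)

text \<open>Being a boundary path depends only on how a path ends, which a finite initial piece does
  not change.\<close>

lemma boundary_pcat:
  assumes "walk E v es" "\<zeta> \<in> epaths_at E (walk_source E v es)"
  shows "pcat (FPath v es) \<zeta> \<in> boundary_paths E \<longleftrightarrow> \<zeta> \<in> boundary_paths E"
proof -
  have "pcat (FPath v es) \<zeta> \<in> epaths E" using pcat_epaths_at[OF assms] by (simp add: epaths_at_def)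
  then show ?thesis using assms by (cases \<zeta>) (auto simp: boundary_iff epaths_at_def)
qed

text \<open>g and its inverse inject the edges at s(g) and those at r(g) into one another, so the
  two sets are finite together and empty together.\<close>

lemma singular_transport:
  assumes "g \<in> garr G" "singular E (gsrc G g)"
  shows "singular E (grng G g)"
proof -
  obtain h where h: "h \<in> garr G" "gsrc G h = grng G g" "grng G h = gsrc G g"
    "gcomp G h g = gid G (gsrc G g)" "gcomp G g h = gid G (grng G g)" using inverseE assms by blast
  have 1: "act G h ` edges_at E (grng G g) \<subseteq> edges_at E (gsrc G g)"
    using act_edges_at(1)[OF h(1)] h by auto
  have "inj_on (act G h) (edges_at E (grng G g))"
    using act_list_inj[OF h(1), of "[_]" "[_]"] h by (intro inj_onI) (auto dest: edges_atD)
  moreover have 2: "act G g ` edges_at E (gsrc G g) \<subseteq> edges_at E (grng G g)"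
    using act_edges_at(1)[OF assms(1)] by auto
  moreover have "inj_on (act G g) (edges_at E (gsrc G g))"
    using act_list_inj[OF assms(1), of "[_]" "[_]"] by (intro inj_onI) (auto dest: edges_atD)
  ultimately have "finite (edges_at E (gsrc G g)) \<longleftrightarrow> finite (edges_at E (grng G g))"
    using 1 inj_on_finite by blast
  moreover have "edges_at E (gsrc G g) = {} \<longleftrightarrow> edges_at E (grng G g) = {}" using 1 2 by blast
  moreover have "grng G g \<in> verts E" using rng_closed[OF assms(1)] objects_eq_verts by simp
  ultimately show ?thesis using assms(2) by (simp add: singular_def)
qed

lemma act_path_boundary:
  assumes "g \<in> garr G" "\<xi> \<in> epaths_at E (gsrc G g)" "\<xi> \<in> boundary_paths E"
  shows "act_path G g \<xi> \<in> boundary_paths E"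
proof (cases \<xi>)
  case (FPath v es)
  then have v: "v = gsrc G g" "walk E v es" "singular E (walk_source E v es)"
    using assms by (auto simp: boundary_iff epaths_at_def)
  then have "singular E (grng G (restr_list G g es))"
    using singular_transport[of "restr_list G g es"] act_list_closed[OF assms(1), of es] by simp
  then show ?thesis using v FPath act_list_closed[OF assms(1), of es] by (auto simp: boundary_iff)
next
  case (IPath t)
  then show ?thesis using act_path_epaths_at[OF assms(1,2)] by (auto simp: boundary_iff epaths_at_def)
qed

text \<open>If no walk from v ends in a singular vertex, every vertex reached from v receives an
  edge, and following edges forever gives an infinite path. Consequently boundary paths are dense:
  every cylinder contains one.\<close>

lemma ex_boundary_path:
  assumes "v \<in> verts E"
  obtains \<zeta> where "\<zeta> \<in> boundary_paths E" "\<zeta> \<in> epaths_at E v"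
proof (cases "\<exists>es. walk E v es \<and> singular E (walk_source E v es)")
  case True
  then obtain es where "walk E v es" "singular E (walk_source E v es)" by blast
  then show ?thesis by (intro that[of "FPath v es"]) (auto simp: boundary_iff epaths_at_def)
next
  case False
  \<comment> \<open>The chosen edge depends only on the current vertex, so the infinite path is the
    orbit of v under the single map \<open>nxt\<close>.\<close>
  define pick where "pick u = (SOME e. e \<in> edges_at E u)" for u
  define nxt where "nxt u = tail E (pick u)" for u
  have pick: "pick u \<in> edges_at E u" if "u \<in> verts E" "\<not> singular E u" for u
    using that unfolding pick_def singular_def by (metis ex_in_conv someI_ex)
  have walk: "walk E u (stake n (smap pick (siterate nxt u)))"
    if "u \<in> verts E" "\<And>es. walk E u es \<Longrightarrow> \<not> singular E (walk_source E u es)" for u n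
    using that
  proof (induction n arbitrary: u)
    case (Suc n)
    have p: "pick u \<in> edges_at E u" using pick Suc.prems(1) Suc.prems(2)[of "[]"] by simp
    moreover have "\<not> singular E (walk_source E (nxt u) es)" if "walk E (nxt u) es" for es
      using Suc.prems(2)[of "pick u # es"] that p by (simp add: nxt_def)
    moreover have "nxt u \<in> verts E" using edges_atD[OF p] by (simp add: nxt_def)
    moreover have "smap pick (siterate nxt u) = pick u ## smap pick (siterate nxt (nxt u))"
      by (simp add: stream.expand)
    ultimately show ?case using Suc.IH[of "nxt u"] by (simp del: stake_smap stake_siterate add: nxt_def[symmetric])
  qed simp
  define t where "t = smap pick (siterate nxt v)"
  have "pick v \<in> edges_at E v" using walk[of v 1] assms False by simp
  then have h: "head E (shd t) = v" by (auto simp: t_def edges_at_def)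
  moreover have "IPath t \<in> ipaths E" using walk[of v] assms False h
    by (auto simp: ipaths_iff_walk_stake t_def)
  ultimately show ?thesis
    by (intro that[of "IPath t"]) (auto simp: boundary_iff epaths_def epaths_at_def)
qed

lemma ex_boundary_extension:
  assumes "walk E v es"
  obtains \<zeta> where "\<zeta> \<in> epaths_at E (walk_source E v es)" "\<zeta> \<in> boundary_paths E"
    "pcat (FPath v es) \<zeta> \<in> boundary_paths E" "pcat (FPath v es) \<zeta> \<in> epaths_at E v"
proof -
  obtain \<zeta> where "\<zeta> \<in> boundary_paths E" "\<zeta> \<in> epaths_at E (walk_source E v es)"
    using ex_boundary_path walk_source_verts[OF assms] by blast
  then show ?thesis using that boundary_pcat[OF assms] pcat_epaths_at[OF assms] by blast
qed

section \<open>Neighbourhoods of paths\<close>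

text \<open>For an intersection, two prefixes of \<xi> are comparable, so the longer one is kept and
  the excluded sets are united. To make this union meaningful, excluded paths are stored as whole
  edge lists from the range of \<xi>, not relative to \<open>es\<close>.\<close>

lemma path_nbhd:
  assumes "openin (path_topology E) V" "\<xi> \<in> V"
  obtains es F where "is_prefix es \<xi>" "finite F" "\<And>fs. fs \<in> F \<Longrightarrow> \<not> is_prefix fs \<xi>"
    "\<And>\<zeta>. \<zeta> \<in> epaths_at E (prange E \<xi>) \<Longrightarrow> is_prefix es \<zeta> \<Longrightarrow> \<forall>fs\<in>F. \<not> is_prefix fs \<zeta> \<Longrightarrow> \<zeta> \<in> V"
proof -
  let ?P = "\<lambda>V \<xi> es F. is_prefix es \<xi> \<and> finite F \<and> (\<forall>fs\<in>F. \<not> is_prefix fs \<xi>) \<and>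
     (\<forall>\<zeta>. \<zeta> \<in> epaths_at E (prange E \<xi>) \<longrightarrow> is_prefix es \<zeta> \<longrightarrow> (\<forall>fs\<in>F. \<not> is_prefix fs \<zeta>) \<longrightarrow> \<zeta> \<in> V)"
  have "\<exists>es F. ?P V \<xi> es F"
    using assms unfolding path_topology_def openin_topology_generated_by_iff
  proof (induction arbitrary: \<xi> rule: generate_topology_on.induct)
    case Empty
    then show ?case by simp
  next
    case (Int A B)
    have "\<xi> \<in> A" "\<xi> \<in> B" using Int.prems by auto
    obtain es F where A: "?P A \<xi> es F" using Int.IH(1)[OF \<open>\<xi> \<in> A\<close>] by (elim exE)
    obtain es' F' where B: "?P B \<xi> es' F'" using Int.IH(2)[OF \<open>\<xi> \<in> B\<close>] by (elim exE)
    consider "prefix es es'" | "prefix es' es"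
      using is_prefix_cases[of es \<xi> es'] A B by auto
    then show ?case
    proof cases
      case 1
      then have "is_prefix es' \<zeta> \<Longrightarrow> is_prefix es \<zeta>" for \<zeta> :: "('v, 'e) epath"
        using is_prefix_prefix by blast
      then have "?P (A \<inter> B) \<xi> es' (F \<union> F')" using A B by blast
      then show ?thesis by blast
    next
      case 2
      then have "is_prefix es \<zeta> \<Longrightarrow> is_prefix es' \<zeta>" for \<zeta> :: "('v, 'e) epath"
        using is_prefix_prefix by blast
      then have "?P (A \<inter> B) \<xi> es (F \<union> F')" using A B by blast
      then show ?thesis by blast
    qed
  next
    case (UN K)
    then obtain k where "k \<in> K" "\<xi> \<in> k" by blast
    with UN(2)[OF this] show ?case by (meson UnionI)
  next
    case (Basis s)
    then obtain \<alpha> F where s: "s = cylinder E \<alpha> - (\<Union>\<beta>\<in>F. cylinder E (pcat \<alpha> \<beta>))" "\<alpha> \<in> fpaths E"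
      "finite F" "F \<subseteq> fpaths_at E (psource E \<alpha>)" by blast
    obtain v es where a: "\<alpha> = FPath v es" "walk E v es" using fpathsE s(2) by blast
    define L where "L = {fs. FPath (walk_source E v es) fs \<in> F}"
    have "inj_on (FPath (walk_source E v es)) L" by (auto intro: inj_onI)
    moreover have "FPath (walk_source E v es) ` L \<subseteq> F" by (auto simp: L_def)
    ultimately have L: "finite L" using s(3) by (meson inj_on_finite)
    have F: "F = FPath (walk_source E v es) ` L"
    proof
      show "F \<subseteq> FPath (walk_source E v es) ` L"
      proof
        fix \<beta> assume b: "\<beta> \<in> F"
        then have "\<beta> \<in> fpaths_at E (walk_source E v es)" using s(4) a by auto
        then obtain fs where "\<beta> = FPath (walk_source E v es) fs" by (auto simp: fpaths_at_iff)
        then show "\<beta> \<in> FPath (walk_source E v es) ` L" using b by (simp add: L_def)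
      qed
    qed (auto simp: L_def)
    have F2: "walk E v (es @ fs)" if "fs \<in> L" for fs
    proof -
      have "FPath (walk_source E v es) fs \<in> fpaths_at E (walk_source E v es)"
        using s(4) a that by (auto simp: L_def)
      then show ?thesis using a(2) by (auto simp: fpaths_at_iff)
    qed
    have "\<zeta> \<in> cylinder E (pcat \<alpha> (FPath (walk_source E v es) fs)) \<longleftrightarrow>
        \<zeta> \<in> epaths_at E v \<and> is_prefix (es @ fs) \<zeta>" if "fs \<in> L" for fs \<zeta>
      using cylinder_iff[OF F2[OF that]] a by simp
    then have in_s: "\<zeta> \<in> s \<longleftrightarrow>
        \<zeta> \<in> epaths_at E v \<and> is_prefix es \<zeta> \<and> (\<forall>fs\<in>L. \<not> is_prefix (es @ fs) \<zeta>)" for \<zeta>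
      unfolding s(1) F using cylinder_iff[OF a(2)] a(1) by auto
    have "prange E \<xi> = v" using Basis(2) in_s by (simp add: epaths_at_def)
    then have "?P s \<xi> es ((@) es ` L)" using Basis(2) L in_s by simp
    then show ?case by blast
  qed
  then show ?thesis using that by blast
qed

text \<open>Excluding single edges is enough for two uses: F = {} gives cylinders, and taking all
  edges at a finite receiver isolates the path ending there.\<close>

lemma openin_path_topology_basic:
  assumes "walk E v es" "finite F" "\<And>f. f \<in> F \<Longrightarrow> f \<in> edges_at E (walk_source E v es)"
  shows "openin (path_topology E)
    {\<xi> \<in> epaths_at E v. is_prefix es \<xi> \<and> (\<forall>f\<in>F. \<not> is_prefix (es @ [f]) \<xi>)}"
  unfolding path_topology_def
proof (rule topology_generated_by_Basis, rule CollectI, intro exI conjI)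
  let ?F = "(\<lambda>f. FPath (walk_source E v es) [f]) ` F"
  have w: "walk E v (es @ [f])" if "f \<in> F" for f
    using assms(1) assms(3)[OF that] by (auto dest: edges_atD)
  show "{\<xi> \<in> epaths_at E v. is_prefix es \<xi> \<and> (\<forall>f\<in>F. \<not> is_prefix (es @ [f]) \<xi>)} =
    cylinder E (FPath v es) - (\<Union>\<beta>\<in>?F. cylinder E (pcat (FPath v es) \<beta>))"
    using w by (auto simp: cylinder_iff[OF assms(1)] cylinder_iff)
  show "finite ?F" using assms by simp
  show "?F \<subseteq> fpaths_at E (psource E (FPath v es))" using w by (auto simp: fpaths_at_iff)
qed (use assms in simp)

lemma openin_cylinder:
  assumes "walk E v es"
  shows "openin (path_topology E) (cylinder E (FPath v es))"
proof -
  have "cylinder E (FPath v es) =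
      {\<xi> \<in> epaths_at E v. is_prefix es \<xi> \<and> (\<forall>f\<in>{}. \<not> is_prefix (es @ [f]) \<xi>)}"
    using cylinder_iff[OF assms] by auto
  then show ?thesis using openin_path_topology_basic[OF assms, of "{}"] by simp
qed

text \<open>If the boundary path ends in an infinite receiver, one of the infinitely many edges there
  avoids the finitely many paths excluded by a basic neighbourhood.\<close>

lemma boundary_nbhd_cylinder:
  assumes V: "openin (path_topology E) V" and "\<xi> \<in> V" and b: "\<xi> \<in> boundary_paths E"
  obtains es where "walk E (prange E \<xi>) es" "cylinder E (FPath (prange E \<xi>) es) \<subseteq> V"
proof -
  let ?v = "prange E \<xi>"
  obtain es F where F: "is_prefix es \<xi>" "finite F" "\<And>fs. fs \<in> F \<Longrightarrow> \<not> is_prefix fs \<xi>"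
    "\<And>\<zeta>. \<zeta> \<in> epaths_at E ?v \<Longrightarrow> is_prefix es \<zeta> \<Longrightarrow> \<forall>fs\<in>F. \<not> is_prefix fs \<zeta> \<Longrightarrow> \<zeta> \<in> V"
    using path_nbhd[OF V \<open>\<xi> \<in> V\<close>] by blast
  have xi: "\<xi> \<in> epaths_at E ?v" using b boundary_iff epaths_at_self by blast
  note result = that
  have goal: ?thesis if w: "walk E ?v xs" and es: "prefix es xs"
    and *: "\<And>\<zeta> fs. \<zeta> \<in> epaths_at E ?v \<Longrightarrow> is_prefix xs \<zeta> \<Longrightarrow> fs \<in> F \<Longrightarrow> \<not> is_prefix fs \<zeta>" for xs
  proof (rule result[OF w])
    show "cylinder E (FPath ?v xs) \<subseteq> V"
    proof
      fix \<zeta> assume "\<zeta> \<in> cylinder E (FPath ?v xs)"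
      then have "\<zeta> \<in> epaths_at E ?v" "is_prefix xs \<zeta>" using cylinder_iff[OF w] by auto
      then show "\<zeta> \<in> V" using F(4) * is_prefix_prefix es by blast
    qed
  qed
  show ?thesis
  proof (cases \<xi>)
    case (IPath t)
    \<comment> \<open>Beyond this length an excluded path that is a prefix of some \<zeta> with
      prefix \<open>stake n t\<close> would be a prefix of \<open>stake n t\<close>, hence of
      \<xi>.\<close>
    define n where "n = Max (insert (length es) (length ` F))"
    have n: "length es \<le> n" "\<And>fs. fs \<in> F \<Longrightarrow> length fs \<le> n"
      using F(2) by (auto simp: n_def)
    let ?xs = "stake n t"
    have xs: "is_prefix ?xs \<xi>" using IPath by simp
    show ?thesis
    proof (rule goal)
      show "walk E ?v ?xs" using xi xs by (simp only: epaths_at_iff)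
      show "prefix es ?xs" using is_prefix_linear[OF F(1) xs] n by simp
      show "\<not> is_prefix fs \<zeta>" if "is_prefix ?xs \<zeta>" "fs \<in> F" for \<zeta> fs
        using is_prefix_linear[of fs \<zeta> ?xs] that n(2) F(3) xs is_prefix_prefix by fastforce
    qed
  next
    case (FPath v xs)
    then have v: "v = ?v" "walk E v xs" "singular E (walk_source E v xs)" using b by (auto simp: boundary_iff)
    show ?thesis
    proof (cases "edges_at E (walk_source E v xs) = {}")
      case True
      \<comment> \<open>No edge continues the path here, so its cylinder is a single point.\<close>
      have "\<zeta> = \<xi>" if "\<zeta> \<in> epaths_at E ?v" "is_prefix xs \<zeta>" for \<zeta>
      proof (rule epath_eqI[of E])
        show "prange E \<zeta> = prange E \<xi>" using that by (simp add: epaths_at_iff)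
        show "is_prefix fs \<zeta> \<longleftrightarrow> is_prefix fs \<xi>" for fs
        proof
          assume fs: "is_prefix fs \<zeta>"
          show "is_prefix fs \<xi>"
          proof (cases "\<exists>ys. fs = xs @ ys")
            case T: True
            then obtain ys where ys: "fs = xs @ ys" by blast
            have "walk E v (xs @ ys)" using fs that ys v by (simp only: epaths_at_iff)
            then show ?thesis using True ys FPath by (cases ys) auto
          next
            case F: False
            then show ?thesis using is_prefix_cases[OF fs that(2)] FPath by auto
          qed
        next
          assume "is_prefix fs \<xi>"
          then show "is_prefix fs \<zeta>" using FPath that(2) by (auto intro: is_prefix_prefix)
        qed
      qed
      then have *: "\<not> is_prefix fs \<zeta>" if "\<zeta> \<in> epaths_at E ?v" "is_prefix xs \<zeta>" "fs \<in> F" for \<zeta> fs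
        using that F(3) by blast
      show ?thesis
      proof (rule goal)
        show "walk E ?v xs" using v by simp
        show "prefix es xs" using F(1) FPath by simp
      qed (rule *)
    next
      case False
      then have "infinite (edges_at E (walk_source E v xs))" using v by (simp add: singular_def)
      \<comment> \<open>For an excluded list that is not longer than \<open>xs\<close> the entry
        \<open>fs ! length xs\<close> is unspecified; it merely removes one more candidate for e.
        Such lists are dealt with by comparing them to \<open>xs\<close>.\<close>
      then obtain e where e: "e \<in> edges_at E (walk_source E v xs)" "e \<notin> (\<lambda>fs. fs ! length xs) ` F"
        using F(2) by (meson finite_imageI finite_subset subsetI)
      show ?thesis
      proof (rule goal)
        show "walk E ?v (xs @ [e])" using e v by (auto dest: edges_atD)
        show "prefix es (xs @ [e])" using F(1) FPath by (simp add: prefix_def) (metis append_assoc)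
        show "\<not> is_prefix fs \<zeta>" if z: "is_prefix (xs @ [e]) \<zeta>" "fs \<in> F" for \<zeta> fs
        proof
          assume fs: "is_prefix fs \<zeta>"
          have xz: "is_prefix xs \<zeta>" using z is_prefix_append_left by blast
          consider zs where "fs = (xs @ [e]) @ zs" | "prefix fs xs"
            using is_prefix_cases[OF fs z(1)] by (auto simp: prefix_def) (metis append_Nil2 butlast_append butlast_snoc)
          then show False
          proof cases
            case 1
            then have "fs ! length xs = e" by simp
            then show False using e(2) z(2) by auto
          next
            case 2
            then show False using F(3)[OF z(2)] FPath by simp
          qed
        qed
      qed
    qed
  qed
qed

end

section \<open>Germs\<close>

context self_similar_action
begin

lemma germ_reps_iff: "(FPath a as, g, FPath b bs, \<xi>) \<in> germ_reps G E \<longleftrightarrow>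
    walk E a as \<and> g \<in> garr G \<and> walk E b bs \<and> grng G g = walk_source E a as \<and>
    gsrc G g = walk_source E b bs \<and> \<xi> \<in> epaths_at E b \<and> is_prefix bs \<xi>"
  by (auto simp: germ_reps_def cylinder_iff)

lemma germ_repsE:
  assumes "x \<in> germ_reps G E"
  obtains a as g b bs \<xi> where "x = (FPath a as, g, FPath b bs, \<xi>)"
proof -
  obtain \<alpha> g \<beta> \<xi> where x: "x = (\<alpha>, g, \<beta>, \<xi>)" by (cases x)
  then have "\<alpha> \<in> fpaths E" "\<beta> \<in> fpaths E" using assms by (auto simp: germ_reps_def)
  then show ?thesis using x that by (metis fpathsE)
qed

lemma germ_reps_FPath:
  assumes "(\<alpha>, g, \<beta>, \<xi>) \<in> germ_reps G E"
  obtains a as b bs where "\<alpha> = FPath a as" "\<beta> = FPath b bs"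
  by (rule germ_repsE[OF assms]) (use that in auto)

text \<open>That \<open>ps\<close> and \<open>qs\<close> are walks follows from
  \<open>bs @ ps\<close> being a prefix of the path \<xi>, so the relation becomes a statement about
  lists. Likewise b = d, both being the range of \<xi>.\<close>

lemma germ_rel_iff: "((FPath a as, g, FPath b bs, \<xi>), (FPath c cs, h, FPath d ds, \<eta>)) \<in> germ_rel G E \<longleftrightarrow>
    (FPath a as, g, FPath b bs, \<xi>) \<in> germ_reps G E \<and> (FPath c cs, h, FPath d ds, \<eta>) \<in> germ_reps G E \<and>
    \<xi> = \<eta> \<and> a = c \<and> (\<exists>ps qs. bs @ ps = ds @ qs \<and> is_prefix (bs @ ps) \<xi> \<and>
      as @ act_list G g ps = cs @ act_list G h qs \<and> restr_list G g ps = restr_list G h qs)"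
  (is "?L \<longleftrightarrow> ?R")
proof
  assume ?L
  then have r: "(FPath a as, g, FPath b bs, \<xi>) \<in> germ_reps G E"
    "(FPath c cs, h, FPath d ds, \<eta>) \<in> germ_reps G E" "\<xi> = \<eta>"
    by (auto simp: germ_rel_def)
  obtain ps qs where w: "walk E (walk_source E b bs) ps" "walk E (walk_source E d ds) qs"
    and e: "bs @ ps = ds @ qs" "\<xi> \<in> cylinder E (FPath b (bs @ ps))"
      "a = c" "as @ act_list G g ps = cs @ act_list G h qs" "restr_list G g ps = restr_list G h qs"
    using \<open>?L\<close> by (auto simp: germ_rel_def fpaths_at_iff)
  have "walk E b (bs @ ps)" using r w by (simp add: germ_reps_iff)
  then have "is_prefix (bs @ ps) \<xi>" using e cylinder_iff by blast
  then show ?R using r e by blast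
next
  assume R: ?R
  then obtain ps qs where e: "bs @ ps = ds @ qs" "is_prefix (bs @ ps) \<xi>" "a = c" "\<xi> = \<eta>"
    "as @ act_list G g ps = cs @ act_list G h qs" "restr_list G g ps = restr_list G h qs" by blast
  have r: "\<xi> \<in> epaths_at E b" "b = d" using R by (auto simp: germ_reps_iff epaths_at_def)
  have w: "walk E b (bs @ ps)" "walk E d (ds @ qs)" using e r unfolding epaths_at_iff by metis+
  have "FPath (walk_source E b bs) ps \<in> fpaths_at E (walk_source E b bs)"
    "FPath (walk_source E d ds) qs \<in> fpaths_at E (walk_source E d ds)"
    using w by (auto simp: fpaths_at_iff)
  moreover have "\<xi> \<in> cylinder E (FPath b (bs @ ps))" using cylinder_iff[OF w(1)] e r by blast
  moreover have "pcat (FPath b bs) (FPath (walk_source E b bs) ps) =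
      pcat (FPath d ds) (FPath (walk_source E d ds) qs)"
    "pcat (FPath a as) (act_path G g (FPath (walk_source E b bs) ps)) =
      pcat (FPath c cs) (act_path G h (FPath (walk_source E d ds) qs))"
    "restr_path G g (FPath (walk_source E b bs) ps) = restr_path G h (FPath (walk_source E d ds) qs)"
    "pcat (FPath b bs) (FPath (walk_source E b bs) ps) = FPath b (bs @ ps)"
    using e r(2) by simp_all
  ultimately show ?L using R unfolding germ_rel_def mem_Collect_eq split_conv psource_FPath by metis
qed

text \<open>For transitivity, the two witnessing prefixes of \<xi> are comparable. A witness may be
  prolonged by the same list on both sides, because the restrictions agree there and hence act
  equally on the added edges; so the shorter one is prolonged to match the longer.\<close>

lemma equiv_germ_rel: "equiv (germ_reps G E) (germ_rel G E)"
proof (rule equivI)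
  show sub: "germ_rel G E \<subseteq> germ_reps G E \<times> germ_reps G E" by (auto simp: germ_rel_def)
  show "refl_on (germ_reps G E) (germ_rel G E)"
  proof (rule refl_onI)
    fix x assume x: "x \<in> germ_reps G E"
    then show "(x, x) \<in> germ_rel G E"
      by (rule germ_repsE) (use x in \<open>auto simp: germ_rel_iff germ_reps_iff intro!: exI[of _ "[]"]\<close>)
  qed
  show "sym (germ_rel G E)"
  proof (rule symI)
    fix x y assume xy: "(x, y) \<in> germ_rel G E"
    obtain a as g b bs \<xi> where x: "x = (FPath a as, g, FPath b bs, \<xi>)" using sub xy germ_repsE by blast
    obtain c cs h d ds \<eta> where y: "y = (FPath c cs, h, FPath d ds, \<eta>)" using sub xy germ_repsE by blast
    show "(y, x) \<in> germ_rel G E" using xy unfolding x y germ_rel_iff by metis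
  qed
  show "trans (germ_rel G E)"
  proof (rule transI)
    fix x y z assume xy: "(x, y) \<in> germ_rel G E" and yz: "(y, z) \<in> germ_rel G E"
    obtain a as g b bs \<xi> where x: "x = (FPath a as, g, FPath b bs, \<xi>)" using sub xy germ_repsE by blast
    obtain c cs h d ds \<eta> where y: "y = (FPath c cs, h, FPath d ds, \<eta>)" using sub xy germ_repsE by blast
    obtain k ks l e es \<theta> where z: "z = (FPath k ks, l, FPath e es, \<theta>)" using sub yz germ_repsE by blast
    obtain ps qs where p: "bs @ ps = ds @ qs" "is_prefix (bs @ ps) \<xi>"
      "as @ act_list G g ps = cs @ act_list G h qs" "restr_list G g ps = restr_list G h qs"
      using xy unfolding x y germ_rel_iff by blast
    obtain qs' rs where r: "ds @ qs' = es @ rs" "is_prefix (ds @ qs') \<eta>"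
      "cs @ act_list G h qs' = ks @ act_list G l rs" "restr_list G h qs' = restr_list G l rs"
      using yz unfolding y z germ_rel_iff by blast
    have o: "\<xi> = \<eta>" "\<eta> = \<theta>" "a = c" "c = k" "x \<in> germ_reps G E" "z \<in> germ_reps G E"
      using xy yz unfolding x y z germ_rel_iff by auto
    have "is_prefix (ds @ qs) \<xi>" "is_prefix (ds @ qs') \<xi>" using p r o by auto
    from is_prefix_cases[OF this] consider xs where "qs' = qs @ xs" | xs where "qs = qs' @ xs" by auto
    then have "\<exists>ps' rs'. bs @ ps' = es @ rs' \<and> is_prefix (bs @ ps') \<xi> \<and>
      as @ act_list G g ps' = ks @ act_list G l rs' \<and> restr_list G g ps' = restr_list G l rs'"
    proof cases
      case 1
      have "bs @ (ps @ xs) = es @ rs" using p(1) r(1) 1 by (metis append_assoc)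
      moreover have "as @ act_list G g (ps @ xs) = ks @ act_list G l rs"
        using p(3,4) r(3) 1 by (metis append_assoc act_list_append)
      moreover have "restr_list G g (ps @ xs) = restr_list G l rs" using p(4) r(4) 1 by simp
      ultimately show ?thesis using r o by metis
    next
      case 2
      have "bs @ ps = es @ (rs @ xs)" using p(1) r(1) 2 by (metis append_assoc)
      moreover have "as @ act_list G g ps = ks @ act_list G l (rs @ xs)"
        using p(3) r(3,4) 2 by (metis append_assoc act_list_append)
      moreover have "restr_list G g ps = restr_list G l (rs @ xs)" using p(4) r(4) 2 by simp
      ultimately show ?thesis using p o by metis
    qed
    then show "(x, z) \<in> germ_rel G E" using o unfolding x z germ_rel_iff by blast
  qed
qed

lemma germ_eq_iff:
  assumes "(\<alpha>, g, \<beta>, \<xi>) \<in> germ_reps G E" "(\<gamma>, h, \<delta>, \<eta>) \<in> germ_reps G E"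
  shows "germ G E \<alpha> g \<beta> \<xi> = germ G E \<gamma> h \<delta> \<eta> \<longleftrightarrow> ((\<alpha>, g, \<beta>, \<xi>), (\<gamma>, h, \<delta>, \<eta>)) \<in> germ_rel G E"
  unfolding germ_def using eq_equiv_class_iff[OF equiv_germ_rel assms] by simp

lemma germ_self:
  assumes "(\<alpha>, g, \<beta>, \<xi>) \<in> germ_reps G E" shows "(\<alpha>, g, \<beta>, \<xi>) \<in> germ G E \<alpha> g \<beta> \<xi>"
  unfolding germ_def using equiv_class_self[OF equiv_germ_rel assms] .

lemma germ_arrow_iff: "\<gamma> \<in> germ_reps G E // germ_rel G E \<longleftrightarrow>
    (\<exists>\<alpha> g \<beta> \<xi>. (\<alpha>, g, \<beta>, \<xi>) \<in> germ_reps G E \<and> \<gamma> = germ G E \<alpha> g \<beta> \<xi>)"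
  by (auto simp: quotient_def germ_def)

lemma germ_arrowE:
  assumes "\<gamma> \<in> germ_reps G E // germ_rel G E"
  obtains a as g b bs \<xi> where "(FPath a as, g, FPath b bs, \<xi>) \<in> germ_reps G E"
    "\<gamma> = germ G E (FPath a as) g (FPath b bs) \<xi>"
proof -
  obtain x where x: "x \<in> germ_reps G E" "\<gamma> = germ_rel G E `` {x}" using assms by (rule quotientE)
  show ?thesis by (rule germ_repsE[OF x(1)]) (use that x in \<open>auto simp: germ_def\<close>)
qed

section \<open>Source, range and units of germs\<close>

lemma germ_source_germ:
  assumes "(\<alpha>, g, \<beta>, \<xi>) \<in> germ_reps G E" shows "germ_source (germ G E \<alpha> g \<beta> \<xi>) = \<xi>"
  unfolding germ_source_def
proof (rule the_equality)
  show "\<exists>\<alpha>' g' \<beta>'. (\<alpha>', g', \<beta>', \<xi>) \<in> germ G E \<alpha> g \<beta> \<xi>" using germ_self[OF assms] by blast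
qed (auto simp: germ_def germ_rel_def)

text \<open>The range is independent of the representative: two equivalent triples send a common
  prefix of \<xi> to the same path with the same restriction, and they act on the same remainder
  \<omega>, obtained by cancelling that prefix.\<close>

lemma germ_range_germ:
  assumes rep: "(FPath a as, g, FPath b bs, pcat (FPath b bs) \<zeta>) \<in> germ_reps G E"
    and z: "\<zeta> \<in> epaths_at E (walk_source E b bs)"
  shows "germ_range G E (germ G E (FPath a as) g (FPath b bs) (pcat (FPath b bs) \<zeta>)) =
    pcat (FPath a as) (act_path G g \<zeta>)"
  unfolding germ_range_def
proof (rule the_equality)
  show "\<exists>\<alpha>' g' \<beta>'. \<exists>\<xi>\<in>epaths_at E (psource E \<beta>').
     (\<alpha>', g', \<beta>', pcat \<beta>' \<xi>) \<in> germ G E (FPath a as) g (FPath b bs) (pcat (FPath b bs) \<zeta>) \<and>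
     pcat (FPath a as) (act_path G g \<zeta>) = pcat \<alpha>' (act_path G g' \<xi>)"
    using germ_self[OF rep] z by (metis psource_FPath)
next
  fix \<rho>
  assume "\<exists>\<alpha>' g' \<beta>'. \<exists>\<xi>\<in>epaths_at E (psource E \<beta>').
     (\<alpha>', g', \<beta>', pcat \<beta>' \<xi>) \<in> germ G E (FPath a as) g (FPath b bs) (pcat (FPath b bs) \<zeta>) \<and>
     \<rho> = pcat \<alpha>' (act_path G g' \<xi>)"
  then obtain \<gamma> h \<delta> \<eta> where h: "\<eta> \<in> epaths_at E (psource E \<delta>)"
    "((FPath a as, g, FPath b bs, pcat (FPath b bs) \<zeta>), (\<gamma>, h, \<delta>, pcat \<delta> \<eta>)) \<in> germ_rel G E"
    "\<rho> = pcat \<gamma> (act_path G h \<eta>)" by (auto simp: germ_def)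
  have rep': "(\<gamma>, h, \<delta>, pcat \<delta> \<eta>) \<in> germ_reps G E" using h(2) by (auto simp: germ_rel_def)
  obtain c cs d ds where cd: "\<gamma> = FPath c cs" "\<delta> = FPath d ds" by (rule germ_reps_FPath[OF rep'])
  obtain ps qs where p: "bs @ ps = ds @ qs" "is_prefix (bs @ ps) (pcat (FPath b bs) \<zeta>)"
    "pcat (FPath b bs) \<zeta> = pcat (FPath d ds) \<eta>" "a = c"
    "as @ act_list G g ps = cs @ act_list G h qs" "restr_list G g ps = restr_list G h qs"
    using h(2) unfolding cd germ_rel_iff by blast
  have "is_prefix ps \<zeta>" using p(2) by simp
  then obtain \<omega> where w: "\<omega> \<in> epaths_at E (walk_source E b (bs @ ps))"
    "\<zeta> = pcat (FPath (walk_source E b bs) ps) \<omega>" using is_prefix_split[OF z] by auto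
  have "is_prefix (ds @ qs) (pcat (FPath d ds) \<eta>)" using p by metis
  then have q: "is_prefix qs \<eta>" by simp
  have "\<eta> \<in> epaths_at E (walk_source E d ds)" using h(1) cd by simp
  then obtain \<omega>' where w': "\<omega>' \<in> epaths_at E (walk_source E d (ds @ qs))"
    "\<eta> = pcat (FPath (walk_source E d ds) qs) \<omega>'" using is_prefix_split[OF _ q] by auto
  have bd: "b = d" using rep rep' p(3) unfolding cd germ_reps_iff epaths_at_def by auto
  have "pcat (FPath b (bs @ ps)) \<omega> = pcat (FPath b (bs @ ps)) \<omega>'"
    using p(1,3) bd unfolding w(2) w'(2) by (metis pcat_assoc)
  moreover have "prange E \<omega> = prange E \<omega>'" using w(1) w'(1) bd p(1) by (simp add: epaths_at_def)
  ultimately have "\<omega> = \<omega>'" by (rule pcat_left_cancel)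
  then show "\<rho> = pcat (FPath a as) (act_path G g \<zeta>)"
    unfolding h(3) cd w(2) w'(2) act_path_pcat pcat_assoc[symmetric] using p(4-6) by simp
qed

lemma germ_unit_rep:
  assumes "\<xi> \<in> epaths E"
  shows "(FPath (prange E \<xi>) [], gid G (prange E \<xi>), FPath (prange E \<xi>) [], \<xi>) \<in> germ_reps G E"
proof -
  have "walk E (prange E \<xi>) []" using assms is_prefix_Nil epaths_iff by blast
  then show ?thesis using gid_closed[of "prange E \<xi>"] epaths_at_self[OF assms] by (simp add: germ_reps_iff)
qed

lemma germ_source_unit:
  assumes "\<xi> \<in> epaths E" shows "germ_source (germ_unit G E \<xi>) = \<xi>"
  using germ_source_germ[OF germ_unit_rep[OF assms]] by (simp add: germ_unit_def Let_def)

text \<open>The unit triple starts with the empty path, so its part of the witness is all of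
  \<open>bs @ ps\<close>, on which it acts trivially. Counting edges, the condition means that
  \<open>as = bs\<close> and that g strongly fixes \<open>ps\<close>.\<close>

lemma germ_eq_unit_iff:
  assumes rep: "(FPath a as, g, FPath b bs, \<xi>) \<in> germ_reps G E"
  shows "germ G E (FPath a as) g (FPath b bs) \<xi> = germ_unit G E \<xi> \<longleftrightarrow>
    a = b \<and> (\<exists>ps. is_prefix (bs @ ps) \<xi> \<and> as @ act_list G g ps = bs @ ps \<and>
      restr_list G g ps = gid G (walk_source E b (bs @ ps)))"
proof -
  have xi: "\<xi> \<in> epaths E" "prange E \<xi> = b" "\<And>es. is_prefix es \<xi> \<Longrightarrow> walk E b es"
    using rep by (auto simp: germ_reps_iff epaths_at_def epaths_iff)
  have rep': "(FPath b [], gid G b, FPath b [], \<xi>) \<in> germ_reps G E" using germ_unit_rep[OF xi(1)] xi(2) by simp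
  have "germ G E (FPath a as) g (FPath b bs) \<xi> = germ_unit G E \<xi> \<longleftrightarrow>
    ((FPath a as, g, FPath b bs, \<xi>), (FPath b [], gid G b, FPath b [], \<xi>)) \<in> germ_rel G E"
    using germ_eq_iff[OF rep rep'] xi(2) by (simp add: germ_unit_def)
  also have "\<dots> \<longleftrightarrow> a = b \<and> (\<exists>ps. is_prefix (bs @ ps) \<xi> \<and>
      as @ act_list G g ps = act_list G (gid G b) (bs @ ps) \<and>
      restr_list G g ps = restr_list G (gid G b) (bs @ ps))"
    unfolding germ_rel_iff using rep rep' by auto
  also have "\<dots> \<longleftrightarrow> a = b \<and> (\<exists>ps. is_prefix (bs @ ps) \<xi> \<and> as @ act_list G g ps = bs @ ps \<and>
      restr_list G g ps = gid G (walk_source E b (bs @ ps)))"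
    using xi(3) act_list_id by metis
  finally show ?thesis .
qed

section \<open>The topology on germs\<close>

text \<open>This is continuity of \<xi> \<mapsto> [\<alpha>, g, \<beta>; \<xi>]. If the germ at
  \<xi> also comes from another triple, the witness \<open>ps\<close>, \<open>qs\<close> only looks
  at the prefix \<open>bs @ ps\<close>, so the two triples agree on its entire cylinder.\<close>

lemma germ_nbhd:
  assumes "openin (germ_topology G E) W" "(FPath a as, g, FPath b bs, \<xi>) \<in> germ_reps G E"
    "germ G E (FPath a as) g (FPath b bs) \<xi> \<in> W"
  obtains V where "openin (path_topology E) V" "\<xi> \<in> V" "V \<subseteq> cylinder E (FPath b bs)"
    "\<And>\<zeta>. \<zeta> \<in> V \<Longrightarrow> germ G E (FPath a as) g (FPath b bs) \<zeta> \<in> W"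
proof -
  let ?g = "germ G E (FPath a as) g (FPath b bs)"
  have rep: "(FPath a as, g, FPath b bs, \<zeta>) \<in> germ_reps G E" if "\<zeta> \<in> cylinder E (FPath b bs)" for \<zeta>
    using assms(2) that by (auto simp: germ_reps_iff cylinder_iff)
  let ?P = "\<lambda>W V. openin (path_topology E) V \<and> \<xi> \<in> V \<and> V \<subseteq> cylinder E (FPath b bs) \<and> (\<forall>\<zeta>\<in>V. ?g \<zeta> \<in> W)"
  have "generate_topology_on {{germ G E \<alpha> g \<beta> \<xi> |\<xi>. \<xi> \<in> V} |\<alpha> g \<beta> V.
        \<alpha> \<in> fpaths E \<and> g \<in> garr G \<and> \<beta> \<in> fpaths E \<and>
        grng G g = psource E \<alpha> \<and> gsrc G g = psource E \<beta> \<and>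
        openin (path_topology E) V \<and> V \<subseteq> cylinder E \<beta>} W"
    using assms(1) unfolding germ_topology_def openin_topology_generated_by_iff .
  then have "?g \<xi> \<in> W \<Longrightarrow> \<exists>V. ?P W V"
  proof (induction rule: generate_topology_on.induct)
    case Empty
    then show ?case by simp
  next
    case (Int A B)
    then obtain V V' where "?P A V" "?P B V'" by blast
    then have "?P (A \<inter> B) (V \<inter> V')" by auto
    then show ?case by blast
  next
    case (UN K)
    then obtain k where "k \<in> K" "?g \<xi> \<in> k" by blast
    with UN(2)[OF this] show ?case by (meson UnionI)
  next
    case (Basis s)
    then obtain \<gamma> h \<delta> V where s: "s = {germ G E \<gamma> h \<delta> \<xi> |\<xi>. \<xi> \<in> V}"
      "\<gamma> \<in> fpaths E" "h \<in> garr G" "\<delta> \<in> fpaths E" "grng G h = psource E \<gamma>" "gsrc G h = psource E \<delta>"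
      "openin (path_topology E) V" "V \<subseteq> cylinder E \<delta>" by blast
    obtain c cs d ds where cd: "\<gamma> = FPath c cs" "\<delta> = FPath d ds"
      using s(2,4) fpathsE by metis
    have rep': "(FPath c cs, h, FPath d ds, \<zeta>) \<in> germ_reps G E" if "\<zeta> \<in> V" for \<zeta>
      using s(2-8) that by (auto simp: germ_reps_def cd)
    obtain \<eta> where e: "\<eta> \<in> V" "?g \<xi> = germ G E \<gamma> h \<delta> \<eta>" using Basis(2) s(1) by blast
    have "((FPath a as, g, FPath b bs, \<xi>), (FPath c cs, h, FPath d ds, \<eta>)) \<in> germ_rel G E"
      using germ_eq_iff[OF assms(2) rep'[OF e(1)]] e cd by simp
    then obtain ps qs where p: "bs @ ps = ds @ qs" "is_prefix (bs @ ps) \<xi>" "a = c" "\<xi> = \<eta>"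
      "as @ act_list G g ps = cs @ act_list G h qs" "restr_list G g ps = restr_list G h qs"
      unfolding germ_rel_iff by blast
    have xi: "\<xi> \<in> epaths_at E b" using assms(2) by (simp add: germ_reps_iff)
    then have w: "walk E b (bs @ ps)" using p(2) epaths_at_iff by blast
    have sub: "cylinder E (FPath b (bs @ ps)) \<subseteq> cylinder E (FPath b bs)"
    proof
      fix \<zeta> assume "\<zeta> \<in> cylinder E (FPath b (bs @ ps))"
      then show "\<zeta> \<in> cylinder E (FPath b bs)"
        using cylinder_iff[OF w] cylinder_iff[of b bs] w is_prefix_append_left by auto
    qed
    have "?P s (V \<inter> cylinder E (FPath b (bs @ ps)))"
    proof (intro conjI ballI)
      show "openin (path_topology E) (V \<inter> cylinder E (FPath b (bs @ ps)))"
        using s(7) openin_cylinder[OF w] by blast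
      show "\<xi> \<in> V \<inter> cylinder E (FPath b (bs @ ps))" using e p xi cylinder_iff[OF w] by simp
      show "V \<inter> cylinder E (FPath b (bs @ ps)) \<subseteq> cylinder E (FPath b bs)" using sub by blast
      fix \<zeta> assume z: "\<zeta> \<in> V \<inter> cylinder E (FPath b (bs @ ps))"
      then have r: "(FPath a as, g, FPath b bs, \<zeta>) \<in> germ_reps G E" using sub rep by blast
      have "((FPath a as, g, FPath b bs, \<zeta>), (FPath c cs, h, FPath d ds, \<zeta>)) \<in> germ_rel G E"
        unfolding germ_rel_iff using r rep' z p cylinder_iff[OF w] by blast
      then have "?g \<zeta> = germ G E \<gamma> h \<delta> \<zeta>" using germ_eq_iff[OF r rep'] z cd by simp
      then show "?g \<zeta> \<in> s" using z s(1) by blast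
    qed
    then show ?case by blast
  qed
  then show ?thesis using assms(3) that by blast
qed

lemma openin_germs:
  assumes "walk E a as" "g \<in> garr G" "walk E b bs" "grng G g = walk_source E a as"
    "gsrc G g = walk_source E b bs" "openin (path_topology E) V" "V \<subseteq> cylinder E (FPath b bs)"
  shows "openin (germ_topology G E) (germ G E (FPath a as) g (FPath b bs) ` V)"
  unfolding germ_topology_def
proof (rule topology_generated_by_Basis, rule CollectI, intro exI conjI)
  show "germ G E (FPath a as) g (FPath b bs) ` V = {germ G E (FPath a as) g (FPath b bs) \<xi> |\<xi>. \<xi> \<in> V}"
    by auto
qed (use assms in auto)

lemma topspace_germ_topology: "topspace (germ_topology G E) \<subseteq> germ_reps G E // germ_rel G E"
  unfolding germ_topology_def topology_generated_by_topspace germ_arrow_iff subset_iff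
  by (auto simp: germ_reps_def) blast

end

section \<open>Topological freeness\<close>

lemma topologically_free_subtopology:
  assumes "gtop \<G> = subtopology T (garr \<G>)"
  shows "topologically_free \<G> \<longleftrightarrow> \<not> (\<exists>W. openin T W \<and> W \<inter> garr \<G> \<noteq> {} \<and>
    (\<forall>\<gamma>\<in>W \<inter> garr \<G>. grng \<G> \<gamma> = gsrc \<G> \<gamma> \<and> \<gamma> \<notin> gid \<G> ` gobj \<G>))"
proof -
  let ?S = "{\<gamma> \<in> garr \<G>. grng \<G> \<gamma> = gsrc \<G> \<gamma>} - gid \<G> ` gobj \<G>"
  have "topologically_free \<G> \<longleftrightarrow> \<not> (\<exists>U. openin (subtopology T (garr \<G>)) U \<and> U \<noteq> {} \<and> U \<subseteq> ?S)"
    unfolding topologically_free_def assms interior_of_eq_empty by blast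
  also have "(\<exists>U. openin (subtopology T (garr \<G>)) U \<and> U \<noteq> {} \<and> U \<subseteq> ?S) \<longleftrightarrow>
      (\<exists>W. openin T W \<and> W \<inter> garr \<G> \<noteq> {} \<and> W \<inter> garr \<G> \<subseteq> ?S)"
    unfolding openin_subtopology by blast
  also have "\<dots> \<longleftrightarrow> (\<exists>W. openin T W \<and> W \<inter> garr \<G> \<noteq> {} \<and>
    (\<forall>\<gamma>\<in>W \<inter> garr \<G>. grng \<G> \<gamma> = gsrc \<G> \<gamma> \<and> \<gamma> \<notin> gid \<G> ` gobj \<G>))"
    by blast
  finally show ?thesis .
qed

text \<open>One description for all six groupoids: Y is the unit space (all paths or boundary
  paths), and B, which is \<open>UNIV\<close>, \<open>germs0\<close> or \<open>germs00\<close>,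
  limits the arrows.\<close>

definition germ_arrows ::
  "('v, 'g, 'e) self_similar \<Rightarrow> ('v, 'e) pre_digraph \<Rightarrow> ('v, 'e) epath set \<Rightarrow>
    ('v, 'g, 'e) germ_rep set set \<Rightarrow> ('v, 'g, 'e) germ_rep set set" where
  "germ_arrows G E Y B = {\<gamma> \<in> germ_reps G E // germ_rel G E.
     germ_source \<gamma> \<in> Y \<and> germ_range G E \<gamma> \<in> Y \<and> \<gamma> \<in> B}"

definition germs_free ::
  "('v, 'g, 'e) self_similar \<Rightarrow> ('v, 'e) pre_digraph \<Rightarrow> ('v, 'e) epath set \<Rightarrow>
    ('v, 'g, 'e) germ_rep set set \<Rightarrow> bool" where
  "germs_free G E Y B \<longleftrightarrow> \<not> (\<exists>W. openin (germ_topology G E) W \<and> W \<inter> germ_arrows G E Y B \<noteq> {} \<and>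
     (\<forall>\<gamma>\<in>W \<inter> germ_arrows G E Y B. germ_range G E \<gamma> = germ_source \<gamma> \<and> \<gamma> \<notin> germ_unit G E ` Y))"

context self_similar_action
begin

text \<open>Neither g nor the exchange of a finite initial piece leaves the boundary, so the source
  alone decides whether a germ survives the restriction to Y.\<close>

lemma germ_range_invariant:
  assumes "Y = epaths E \<or> Y = boundary_paths E"
    "(FPath a as, g, FPath b bs, \<xi>) \<in> germ_reps G E" "\<xi> \<in> Y"
  shows "germ_range G E (germ G E (FPath a as) g (FPath b bs) \<xi>) \<in> Y"
proof -
  note r = assms(2)[unfolded germ_reps_iff]
  obtain \<zeta> where z: "\<zeta> \<in> epaths_at E (walk_source E b bs)" "\<xi> = pcat (FPath b bs) \<zeta>"
    using r is_prefix_split by metis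
  have az: "act_path G g \<zeta> \<in> epaths_at E (walk_source E a as)"
    using act_path_epaths_at[of g \<zeta>] z r by simp
  have "pcat (FPath a as) (act_path G g \<zeta>) \<in> Y"
    using assms(1)
  proof
    assume "Y = epaths E"
    then show ?thesis using pcat_epaths_at[OF _ az] r by (simp add: epaths_at_def)
  next
    assume Y: "Y = boundary_paths E"
    then have "\<zeta> \<in> boundary_paths E" using boundary_pcat[of b bs \<zeta>] z r assms(3) by simp
    then have "act_path G g \<zeta> \<in> boundary_paths E" using act_path_boundary[of g \<zeta>] r z by simp
    then show ?thesis using boundary_pcat[OF _ az] r Y by simp
  qed
  then show ?thesis using germ_range_germ[of a as g b bs \<zeta>] z assms(2) by simp
qed

lemma germ_arrows_epaths: "germ_arrows G E (epaths E) B = germ_reps G E // germ_rel G E \<inter> B"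
proof -
  have "germ_source \<gamma> \<in> epaths E \<and> germ_range G E \<gamma> \<in> epaths E" if \<gamma>: "\<gamma> \<in> germ_reps G E // germ_rel G E" for \<gamma>
  proof -
    obtain a as g b bs \<xi> where x: "(FPath a as, g, FPath b bs, \<xi>) \<in> germ_reps G E"
      "\<gamma> = germ G E (FPath a as) g (FPath b bs) \<xi>" using germ_arrowE[OF \<gamma>] .
    have "\<xi> \<in> epaths E" using x(1) unfolding germ_reps_iff epaths_at_def by simp
    then show ?thesis using germ_source_germ[OF x(1)] germ_range_invariant x by simp
  qed
  then show ?thesis by (auto simp: germ_arrows_def)
qed

lemma topologically_free_iff_germs_free:
  "topologically_free (groupoid_tilde G E) \<longleftrightarrow> germs_free G E (epaths E) UNIV"
  "topologically_free (groupoid0_tilde G E) \<longleftrightarrow> germs_free G E (epaths E) (germs0 G E)"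
  "topologically_free (groupoid00_tilde G E) \<longleftrightarrow> germs_free G E (epaths E) (germs00 G E)"
  "topologically_free (tight_groupoid G E) \<longleftrightarrow> germs_free G E (boundary_paths E) UNIV"
  "topologically_free (tight_groupoid0 G E) \<longleftrightarrow> germs_free G E (boundary_paths E) (germs0 G E)"
  "topologically_free (tight_groupoid00 G E) \<longleftrightarrow> germs_free G E (boundary_paths E) (germs00 G E)"
proof -
  let ?T = "germ_topology G E" and ?R = "germ_reps G E // germ_rel G E"
  have free: "topologically_free \<G> \<longleftrightarrow> germs_free G E Y B"
    if "gtop \<G> = subtopology ?T (germ_arrows G E Y B)" "garr \<G> = germ_arrows G E Y B" "gobj \<G> = Y"
      "grng \<G> = germ_range G E" "gsrc \<G> = germ_source" "gid \<G> = germ_unit G E" for \<G> :: "(('v, 'e) epath, ('v, 'g, 'e) germ_rep set) top_groupoid" and Y B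
    unfolding germs_free_def using topologically_free_subtopology[of \<G> ?T] that by simp
  have T: "subtopology ?T ?R = ?T" using topspace_germ_topology by (rule subtopology_superset)
  have b: "epaths E \<inter> boundary_paths E = boundary_paths E" using boundary_epaths by auto
  have arr: "{\<gamma> \<in> ?R. germ_source \<gamma> \<in> boundary_paths E \<and> germ_range G E \<gamma> \<in> boundary_paths E} \<inter> B =
    germ_arrows G E (boundary_paths E) B" for B by (auto simp: germ_arrows_def)
  show "topologically_free (groupoid_tilde G E) \<longleftrightarrow> germs_free G E (epaths E) UNIV"
    by (rule free) (simp_all add: groupoid_tilde_def germ_arrows_epaths T)
  show "topologically_free (groupoid0_tilde G E) \<longleftrightarrow> germs_free G E (epaths E) (germs0 G E)"
    by (rule free) (simp_all add: groupoid_tilde_def groupoid0_tilde_def restrict_arrows_def germ_arrows_epaths)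
  show "topologically_free (groupoid00_tilde G E) \<longleftrightarrow> germs_free G E (epaths E) (germs00 G E)"
    by (rule free) (simp_all add: groupoid_tilde_def groupoid00_tilde_def restrict_arrows_def germ_arrows_epaths)
  have tight: "gtop (tight_groupoid G E) = subtopology ?T (germ_arrows G E (boundary_paths E) UNIV)"
    "garr (tight_groupoid G E) = germ_arrows G E (boundary_paths E) UNIV" "gobj (tight_groupoid G E) = boundary_paths E"
    "grng (tight_groupoid G E) = germ_range G E" "gsrc (tight_groupoid G E) = germ_source"
    "gid (tight_groupoid G E) = germ_unit G E"
    using arr[of UNIV] b by (simp_all add: tight_groupoid_def restrict_objects_def Let_def groupoid_tilde_def)
  show "topologically_free (tight_groupoid G E) \<longleftrightarrow> germs_free G E (boundary_paths E) UNIV"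
    by (rule free) (simp_all add: tight)
  have arr': "germ_arrows G E (boundary_paths E) UNIV \<inter> B = germ_arrows G E (boundary_paths E) B" for B
    by (auto simp: germ_arrows_def)
  \<comment> \<open>Restricting first objects and then arrows intersects the topology twice with the
    tight arrows; simplification produces this nested set.\<close>
  have "germ_arrows G E (boundary_paths E) (germ_arrows G E (boundary_paths E) B) =
      germ_arrows G E (boundary_paths E) B" for B
    by (auto simp: germ_arrows_def)
  note arr'' = arr' this
  show "topologically_free (tight_groupoid0 G E) \<longleftrightarrow> germs_free G E (boundary_paths E) (germs0 G E)"
    by (rule free) (simp_all add: tight_groupoid0_def restrict_arrows_def tight arr'' subtopology_subtopology)
  show "topologically_free (tight_groupoid00 G E) \<longleftrightarrow> germs_free G E (boundary_paths E) (germs00 G E)"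
    by (rule free) (simp_all add: tight_groupoid00_def restrict_arrows_def tight arr'' subtopology_subtopology)
qed

section \<open>Failure of freeness expressed by a triple and an open set\<close>

lemma not_germs_freeI:
  assumes ab: "walk E a as" "g \<in> garr G" "walk E b bs" "grng G g = walk_source E a as"
    "gsrc G g = walk_source E b bs"
    and V: "openin (path_topology E) V" "V \<subseteq> cylinder E (FPath b bs)" and "Y \<subseteq> epaths E" "V \<inter> Y \<noteq> {}"
    and iso: "\<And>\<xi>. \<xi> \<in> V \<Longrightarrow> \<xi> \<in> Y \<Longrightarrow> germ_range G E (germ G E (FPath a as) g (FPath b bs) \<xi>) = \<xi>"
    and non_unit: "\<And>\<xi>. \<xi> \<in> V \<Longrightarrow> \<xi> \<in> Y \<Longrightarrow> germ G E (FPath a as) g (FPath b bs) \<xi> \<noteq> germ_unit G E \<xi>"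
    and B: "\<And>\<xi>. \<xi> \<in> V \<Longrightarrow> \<xi> \<in> Y \<Longrightarrow> germ G E (FPath a as) g (FPath b bs) \<xi> \<in> B"
  shows "\<not> germs_free G E Y B"
proof -
  let ?g = "germ G E (FPath a as) g (FPath b bs)"
  have rep: "(FPath a as, g, FPath b bs, \<xi>) \<in> germ_reps G E" if "\<xi> \<in> V" for \<xi>
    using ab V(2) that by (auto simp: germ_reps_iff cylinder_iff)
  have arr: "?g \<xi> \<in> germ_arrows G E Y B" if "\<xi> \<in> V" "\<xi> \<in> Y" for \<xi>
    using germ_source_germ[OF rep[OF that(1)]] iso[OF that] B[OF that] rep[OF that(1)] that(2)
    unfolding germ_arrows_def germ_arrow_iff by auto
  have "germ_range G E \<gamma> = germ_source \<gamma> \<and> \<gamma> \<notin> germ_unit G E ` Y"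
    if \<gamma>: "\<gamma> \<in> ?g ` V \<inter> germ_arrows G E Y B" for \<gamma>
  proof -
    obtain \<xi> where x: "\<gamma> = ?g \<xi>" "\<xi> \<in> V" using \<gamma> by blast
    have s: "germ_source \<gamma> = \<xi>" using germ_source_germ[OF rep] x by simp
    then have "\<xi> \<in> Y" using \<gamma> by (auto simp: germ_arrows_def)
    \<comment> \<open>A unit is determined by its source, so the only unit that \<gamma> could equal
      is the one at \<xi>.\<close>
    moreover have "\<gamma> \<noteq> germ_unit G E \<eta>" if "\<eta> \<in> Y" for \<eta>
      using s germ_source_unit[of \<eta>] non_unit[of \<xi>] that \<open>Y \<subseteq> epaths E\<close> x by auto
    ultimately show ?thesis using iso x s by auto
  qed
  moreover have "?g ` V \<inter> germ_arrows G E Y B \<noteq> {}" using \<open>V \<inter> Y \<noteq> {}\<close> arr by blast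
  ultimately show ?thesis using openin_germs[OF ab V] unfolding germs_free_def by blast
qed

text \<open>Membership in B has to persist while \<xi> varies, so the representative is taken from
  the definition of B, where the triple alone decides. In \<open>germs00\<close> the two lengths
  agree since the action preserves length.\<close>

lemma germ_arrows_rep:
  assumes B: "B = UNIV \<or> B = germs0 G E \<or> B = germs00 G E"
    and "\<gamma> \<in> germ_arrows G E Y B"
  obtains a as g b bs \<xi> where "(FPath a as, g, FPath b bs, \<xi>) \<in> germ_reps G E"
    "\<gamma> = germ G E (FPath a as) g (FPath b bs) \<xi>" "B = germs0 G E \<or> B = germs00 G E \<Longrightarrow> length as = length bs"
    "\<And>\<zeta>. \<zeta> \<in> cylinder E (FPath b bs) \<Longrightarrow> germ G E (FPath a as) g (FPath b bs) \<zeta> \<in> B"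
proof -
  \<comment> \<open>The inequalities make the claim on lengths vacuous in the first case.\<close>
  consider "B = UNIV" "B \<noteq> germs0 G E" "B \<noteq> germs00 G E" | "B = germs0 G E" | "B = germs00 G E" using B by blast
  then show ?thesis
  proof cases
    case 1
    have "\<gamma> \<in> germ_reps G E // germ_rel G E" using assms(2) by (simp add: germ_arrows_def)
    then show ?thesis by (rule germ_arrowE) (use 1 that in auto)
  next
    case 2
    then obtain \<alpha> g \<beta> \<xi> where x: "(\<alpha>, g, \<beta>, \<xi>) \<in> germ_reps G E" "\<gamma> = germ G E \<alpha> g \<beta> \<xi>"
      "plength \<alpha> = plength \<beta>" using assms(2) unfolding germ_arrows_def germs0_def by blast
    obtain a as b bs where ab: "\<alpha> = FPath a as" "\<beta> = FPath b bs" by (rule germ_reps_FPath[OF x(1)])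
    have "germ G E (FPath a as) g (FPath b bs) \<zeta> \<in> B" if "\<zeta> \<in> cylinder E (FPath b bs)" for \<zeta>
    proof -
      have "(\<alpha>, g, \<beta>, \<zeta>) \<in> germ_reps G E" using x(1) that ab by (auto simp: germ_reps_def)
      then show ?thesis using 2 x(3) ab unfolding germs0_def by blast
    qed
    then show ?thesis using x ab by (intro that[of a as g b bs \<xi>]) auto
  next
    case 3
    then obtain g \<beta> \<xi> where x: "\<gamma> = germ G E (act_path G g \<beta>) (restr_path G g \<beta>) \<beta> (pcat \<beta> \<xi>)"
      "g \<in> garr G" "\<beta> \<in> fpaths E" "gsrc G g = prange E \<beta>" "\<xi> \<in> epaths_at E (psource E \<beta>)"
      using assms(2) unfolding germ_arrows_def germs00_def by blast
    obtain b bs where b: "\<beta> = FPath b bs" "walk E b bs" using x(3) fpathsE by blast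
    note c = act_list_closed[OF x(2), of bs]
    have "(FPath (grng G g) (act_list G g bs), restr_list G g bs, FPath b bs, pcat \<beta> \<xi>) \<in> germ_reps G E"
      using c b x pcat_epaths_at[OF b(2)] by (simp add: germ_reps_iff)
    moreover have "germ G E (FPath (grng G g) (act_list G g bs)) (restr_list G g bs) (FPath b bs) \<zeta> \<in> B"
      if \<zeta>: "\<zeta> \<in> cylinder E (FPath b bs)" for \<zeta>
    proof -
      obtain \<eta> where "\<eta> \<in> epaths_at E (psource E \<beta>)" "\<zeta> = pcat \<beta> \<eta>" using \<zeta> b by (auto simp: cylinder_def)
      then have "germ G E (act_path G g \<beta>) (restr_path G g \<beta>) \<beta> \<zeta> \<in> B"
        using 3 x unfolding germs00_def by blast
      then show ?thesis using b by simp
    qed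
    ultimately show ?thesis using x(1) b
      by (intro that[of "grng G g" "act_list G g bs" "restr_list G g bs" b bs "pcat \<beta> \<xi>"]) auto
  qed
qed

lemma not_germs_freeE:
  assumes nf: "\<not> germs_free G E Y B" and Y: "Y = epaths E \<or> Y = boundary_paths E"
    and B: "B = UNIV \<or> B = germs0 G E \<or> B = germs00 G E"
  obtains a as g b bs V \<xi> where "walk E a as" "g \<in> garr G" "walk E b bs" "grng G g = walk_source E a as"
    "gsrc G g = walk_source E b bs" "openin (path_topology E) V" "V \<subseteq> cylinder E (FPath b bs)"
    "\<xi> \<in> V" "\<xi> \<in> Y" "B = germs0 G E \<or> B = germs00 G E \<Longrightarrow> length as = length bs"
    "\<And>\<zeta>. \<zeta> \<in> V \<Longrightarrow> \<zeta> \<in> Y \<Longrightarrow> germ_range G E (germ G E (FPath a as) g (FPath b bs) \<zeta>) = \<zeta>"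
    "\<And>\<zeta>. \<zeta> \<in> V \<Longrightarrow> \<zeta> \<in> Y \<Longrightarrow> germ G E (FPath a as) g (FPath b bs) \<zeta> \<noteq> germ_unit G E \<zeta>"
proof -
  obtain W where W: "openin (germ_topology G E) W" "W \<inter> germ_arrows G E Y B \<noteq> {}"
    "\<And>\<gamma>. \<gamma> \<in> W \<Longrightarrow> \<gamma> \<in> germ_arrows G E Y B \<Longrightarrow> germ_range G E \<gamma> = germ_source \<gamma> \<and> \<gamma> \<notin> germ_unit G E ` Y"
    using nf unfolding germs_free_def by blast
  then obtain \<gamma> where c: "\<gamma> \<in> W" "\<gamma> \<in> germ_arrows G E Y B" by blast
  obtain a as g b bs \<xi> where x: "(FPath a as, g, FPath b bs, \<xi>) \<in> germ_reps G E"
    "\<gamma> = germ G E (FPath a as) g (FPath b bs) \<xi>" "B = germs0 G E \<or> B = germs00 G E \<Longrightarrow> length as = length bs"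
    "\<And>\<zeta>. \<zeta> \<in> cylinder E (FPath b bs) \<Longrightarrow> germ G E (FPath a as) g (FPath b bs) \<zeta> \<in> B"
    using germ_arrows_rep[OF B c(2)] by blast
  let ?g = "germ G E (FPath a as) g (FPath b bs)"
  note r = x(1)[unfolded germ_reps_iff]
  obtain V where V: "openin (path_topology E) V" "\<xi> \<in> V" "V \<subseteq> cylinder E (FPath b bs)"
    "\<And>\<zeta>. \<zeta> \<in> V \<Longrightarrow> ?g \<zeta> \<in> W" using germ_nbhd[OF W(1) x(1)] c x(2) by blast
  have "germ_source \<gamma> = \<xi>" using germ_source_germ[OF x(1)] x(2) by simp
  then have xi: "\<xi> \<in> Y" using c(2) by (auto simp: germ_arrows_def)
  have *: "germ_range G E (?g \<zeta>) = \<zeta> \<and> ?g \<zeta> \<notin> germ_unit G E ` Y" if z: "\<zeta> \<in> V" "\<zeta> \<in> Y" for \<zeta>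
  proof -
    have rep: "(FPath a as, g, FPath b bs, \<zeta>) \<in> germ_reps G E"
      using r z V(3) by (auto simp: germ_reps_iff cylinder_iff)
    have s: "germ_source (?g \<zeta>) = \<zeta>" using germ_source_germ[OF rep] .
    have "?g \<zeta> \<in> germ_arrows G E Y B"
      using germ_range_invariant[OF Y rep z(2)] s z x(4) V(3) rep
      by (auto simp: germ_arrows_def germ_arrow_iff)
    then show ?thesis using W(3)[OF V(4)[OF z(1)]] s by simp
  qed
  then show ?thesis using r x(3) V xi by (intro that[of a as g b bs V \<xi>]) auto
qed

end

section \<open>Failure of topological freeness\<close>

context self_similar_action
begin

lemma pcat_Nil: "prange E \<xi> = v \<Longrightarrow> pcat (FPath v []) \<xi> = \<xi>"
  by (cases \<xi>) auto

text \<open>Germs whose two paths are vertices belong to all three arrow sets, so one witness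
  refutes freeness for every choice of B at once.\<close>

lemma vertex_germ_mem:
  assumes "B = UNIV \<or> B = germs0 G E \<or> B = germs00 G E" and g: "g \<in> garr G"
    and xi: "\<xi> \<in> epaths_at E (gsrc G g)"
  shows "germ G E (FPath (grng G g) []) g (FPath (gsrc G g) []) \<xi> \<in> B"
proof -
  have v: "gsrc G g \<in> verts E" "grng G g \<in> verts E"
    using g src_closed rng_closed objects_eq_verts by auto
  have rep: "(FPath (grng G g) [], g, FPath (gsrc G g) [], \<xi>) \<in> germ_reps G E"
    using v g xi by (simp add: germ_reps_iff)
  have "germ G E (FPath (grng G g) []) g (FPath (gsrc G g) []) \<xi> \<in> germs0 G E"
    unfolding germs0_def using rep by force
  moreover have "germ G E (act_path G g (FPath (gsrc G g) [])) (restr_path G g (FPath (gsrc G g) []))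
      (FPath (gsrc G g) []) (pcat (FPath (gsrc G g) []) \<xi>) \<in> germs00 G E"
    unfolding germs00_def using g v xi
    by (intro CollectI exI[of _ g] exI[of _ "FPath (gsrc G g) []"] exI[of _ \<xi>]) simp
  then have "germ G E (FPath (grng G g) []) g (FPath (gsrc G g) []) \<xi> \<in> germs00 G E"
    using pcat_Nil[of \<xi> "gsrc G g"] xi by (simp add: epaths_at_def)
  ultimately show ?thesis using assms(1) by auto
qed

lemma germ_range_vertex_germ:
  assumes "g \<in> garr G" "grng G g = walk_source E a as" "walk E a as" "\<xi> \<in> epaths_at E (gsrc G g)"
  shows "germ_range G E (germ G E (FPath a as) g (FPath (gsrc G g) []) \<xi>) = pcat (FPath a as) (act_path G g \<xi>)"
proof -
  have v: "gsrc G g \<in> verts E" using assms src_closed objects_eq_verts by auto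
  have p: "pcat (FPath (gsrc G g) []) \<xi> = \<xi>" using assms by (intro pcat_Nil) (simp add: epaths_at_def)
  have "(FPath a as, g, FPath (gsrc G g) [], \<xi>) \<in> germ_reps G E"
    using assms v by (simp add: germ_reps_iff)
  then show ?thesis using germ_range_germ[of a as g "gsrc G g" "[]" \<xi>] p assms(4) by simp
qed

text \<open>The witness is the germ [v, g, v; \<xi>] with v = s(g) and V all paths at v. Fixing all
  finite paths at v, g fixes the infinite ones too; a unit among these germs would yield a prefix of
  \<xi> that is strongly fixed.\<close>

lemma not_germs_free_if_not_Evr:
  assumes "\<not> cond_Evr G E" and Y: "Y = epaths E \<or> Y = boundary_paths E"
    and B: "B = UNIV \<or> B = germs0 G E \<or> B = germs00 G E"
  shows "\<not> germs_free G E Y B"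
proof -
  obtain g where g: "g \<in> garr G"
    and fix_all: "\<And>\<mu>. \<mu> \<in> fpaths_at E (gsrc G g) \<Longrightarrow> fixes_path G E g \<mu>"
    and no_strong: "\<And>\<mu>. \<mu> \<in> fpaths_at E (gsrc G g) \<Longrightarrow> \<not> strongly_fixes G E g \<mu>"
    using assms(1) unfolding cond_Evr_def by blast
  let ?v = "gsrc G g"
  have v: "?v \<in> verts E" using g src_closed objects_eq_verts by auto
  have act: "act_list G g es = es \<and> grng G g = ?v" if "walk E ?v es" for es
  proof -
    have "fixes_path G E g (FPath ?v es)" using fix_all that by (simp add: fpaths_at_iff)
    then show ?thesis by (simp add: fixes_path_def)
  qed
  \<comment> \<open>The vertex v is itself one of the fixed paths, and g sends it to r(g).\<close>
  have r: "grng G g = ?v" using act[of "[]"] v by simp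
  have cyl: "\<xi> \<in> cylinder E (FPath ?v []) \<longleftrightarrow> \<xi> \<in> epaths_at E ?v" for \<xi>
    using cylinder_iff[of ?v "[]"] v by simp
  have fixed: "act_path G g \<xi> = \<xi>" if xi: "\<xi> \<in> epaths_at E ?v" for \<xi>
  proof (rule epath_eqI[of E])
    show "prange E (act_path G g \<xi>) = prange E \<xi>"
      using prange_act_path[OF g xi] xi r by (simp add: epaths_at_def)
    show "is_prefix es (act_path G g \<xi>) \<longleftrightarrow> is_prefix es \<xi>" for es
      using xi act unfolding is_prefix_act_path epaths_at_iff by metis
  qed
  show ?thesis
  proof (rule not_germs_freeI)
    show "walk E ?v []" "walk E ?v []" "grng G g = walk_source E ?v []" "gsrc G g = walk_source E ?v []"
      using v r by auto
    show "openin (path_topology E) (cylinder E (FPath ?v []))" using openin_cylinder v by simp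
    obtain \<zeta> where "\<zeta> \<in> boundary_paths E" "\<zeta> \<in> epaths_at E ?v" using ex_boundary_path[OF v] .
    then have "\<zeta> \<in> cylinder E (FPath ?v []) \<inter> Y" using Y boundary_epaths cyl by auto
    then show "cylinder E (FPath ?v []) \<inter> Y \<noteq> {}" by blast
    show "Y \<subseteq> epaths E" using Y boundary_epaths by blast
    fix \<xi> assume "\<xi> \<in> cylinder E (FPath ?v [])"
    then have xi: "\<xi> \<in> epaths_at E ?v" using cyl by simp
    have p: "pcat (FPath ?v []) \<xi> = \<xi>" using xi by (intro pcat_Nil) (simp add: epaths_at_def)
    show "germ_range G E (germ G E (FPath ?v []) g (FPath ?v []) \<xi>) = \<xi>"
      using germ_range_vertex_germ[OF g, of ?v "[]" \<xi>] xi v r fixed[OF xi] p by simp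
    show "germ G E (FPath ?v []) g (FPath ?v []) \<xi> \<in> B"
      using vertex_germ_mem[OF B g xi] r by simp
    have rep: "(FPath ?v [], g, FPath ?v [], \<xi>) \<in> germ_reps G E"
      using g v r xi by (simp add: germ_reps_iff)
    show "germ G E (FPath ?v []) g (FPath ?v []) \<xi> \<noteq> germ_unit G E \<xi>"
    proof
      assume "germ G E (FPath ?v []) g (FPath ?v []) \<xi> = germ_unit G E \<xi>"
      then obtain ps where ps: "is_prefix ps \<xi>" "restr_list G g ps = gid G (walk_source E ?v ps)"
        unfolding germ_eq_unit_iff[OF rep] by auto
      have w: "walk E ?v ps" using ps(1) xi epaths_at_iff by blast
      then have "strongly_fixes G E g (FPath ?v ps)"
        using ps act[OF w] by (simp add: strongly_fixes_def fpaths_at_iff)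
      then show False using no_strong w by (auto simp: fpaths_at_iff)
    qed
  qed (use g in auto)
qed

text \<open>At a finite receiver w = s(\<alpha>) the vertex w is an isolated point, and h =
  g|\<alpha> is a non-unit from w to w. So the single germ [w, h, w; w] is an open set of non-unit
  isotropy.\<close>

lemma not_germs_free_if_not_Rec:
  assumes "\<not> cond_Rec G E" and B: "B = UNIV \<or> B = germs0 G E \<or> B = germs00 G E"
  shows "\<not> germs_free G E (epaths E) B"
proof -
  obtain g \<alpha> where g: "g \<in> garr G" "\<alpha> \<in> fpaths E" "fixes_path G E g \<alpha>"
    "finite_receiver E (psource E \<alpha>)" "\<not> strongly_fixes G E g \<alpha>"
    using assms(1) unfolding cond_Rec_def by blast
  obtain v es where a: "\<alpha> = FPath v es" "walk E v es" using fpathsE g(2) by blast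
  have v: "gsrc G g = v" "grng G g = v" "act_list G g es = es"
    using g(3) a by (auto simp: fixes_path_def epaths_at_def)
  let ?w = "walk_source E v es" and ?h = "restr_list G g es"
  have h: "?h \<in> garr G" "gsrc G ?h = ?w" "grng G ?h = ?w"
    using act_list_closed[OF g(1), of es] v a(2) by auto
  have w: "?w \<in> verts E" "finite (edges_at E ?w)" using g(4) a by (auto simp: finite_receiver_def)
  have ne: "?h \<noteq> gid G ?w" using g(5) a v by (auto simp: strongly_fixes_def fpaths_at_iff)
  have sing: "\<xi> = FPath ?w []" if xi: "\<xi> \<in> epaths_at E ?w" and no: "\<forall>f\<in>edges_at E ?w. \<not> is_prefix [f] \<xi>" for \<xi>
  proof (cases \<xi>)
    case (FPath u fs)
    then have "u = ?w" "walk E ?w fs" using xi by (auto simp: epaths_at_def)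
    then show ?thesis using no FPath by (cases fs) auto
  next
    case (IPath t)
    then have "is_prefix [shd t] \<xi>" by simp
    moreover from this have "walk E ?w [shd t]" using xi epaths_at_iff by blast
    ultimately show ?thesis using no by auto
  qed
  \<comment> \<open>All edges at w are excluded, which is permitted because there are finitely many;
    only the path of length zero is left.\<close>
  let ?V = "{\<xi> \<in> epaths_at E ?w. is_prefix [] \<xi> \<and> (\<forall>f\<in>edges_at E ?w. \<not> is_prefix ([] @ [f]) \<xi>)}"
  have V: "?V = {FPath ?w []}"
    using sing w by (auto simp: epaths_at_iff)
  have e: "FPath ?w [] \<in> epaths_at E ?w" using w by (simp add: epaths_at_def)
  have rep: "(FPath ?w [], ?h, FPath ?w [], FPath ?w []) \<in> germ_reps G E"
    using h w e by (simp add: germ_reps_iff)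
  have 1: "germ_range G E (germ G E (FPath ?w []) ?h (FPath ?w []) (FPath ?w [])) = FPath ?w []"
    using germ_range_vertex_germ[OF h(1), of ?w "[]" "FPath ?w []"] h e w by simp
  have 2: "germ G E (FPath ?w []) ?h (FPath ?w []) (FPath ?w []) \<noteq> germ_unit G E (FPath ?w [])"
    using ne unfolding germ_eq_unit_iff[OF rep] by auto
  have 3: "germ G E (FPath ?w []) ?h (FPath ?w []) (FPath ?w []) \<in> B"
    using vertex_germ_mem[OF B h(1), of "FPath ?w []"] h e by simp
  show ?thesis
  proof (rule not_germs_freeI)
    show "walk E ?w []" "walk E ?w []" "?h \<in> garr G" "grng G ?h = walk_source E ?w []"
      "gsrc G ?h = walk_source E ?w []" using w h by auto
    show "openin (path_topology E) {FPath ?w []}"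
      using openin_path_topology_basic[of ?w "[]" "edges_at E ?w"] w unfolding V[symmetric] by simp
    show "{FPath ?w []} \<subseteq> cylinder E (FPath ?w [])" using w e by (simp add: cylinder_iff)
  qed (use 1 2 3 w in auto)
qed

text \<open>A walk starting in S stays in S, where no vertex is singular and each offers exactly one
  edge. Hence boundary paths from S are infinite, and each prefix is determined by its
  length.\<close>

lemma boundary_path_unique:
  assumes S: "\<And>u. u \<in> S \<Longrightarrow> \<exists>e. edges_at E u = {e} \<and> tail E e \<in> S" and "u \<in> S"
    and xi: "\<xi> \<in> epaths_at E u" "\<xi> \<in> boundary_paths E" and z: "\<zeta> \<in> epaths_at E u" "\<zeta> \<in> boundary_paths E"
  shows "\<xi> = \<zeta>"
proof -
  have end_S: "walk_source E u es \<in> S" if "u \<in> S" "walk E u es" for u es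
    using that
  proof (induction es arbitrary: u)
    case (Cons e es)
    then have "tail E e \<in> S" using S[OF Cons.prems(1)] by auto
    then show ?case using Cons by simp
  qed simp
  have uniq: "es = fs" if "u \<in> S" "walk E u es" "walk E u fs" "length es = length fs" for u es fs
    using that
  proof (induction es arbitrary: u fs)
    case (Cons e es)
    then obtain f fs' where f: "fs = f # fs'" by (cases fs) auto
    have "e = f" "tail E e \<in> S" using S[OF Cons.prems(1)] Cons.prems f by auto
    then show ?case using Cons.IH[of "tail E e" fs'] Cons.prems f by simp
  qed simp
  have inf: "\<exists>t. \<xi> = IPath t" if "\<xi> \<in> epaths_at E u" "\<xi> \<in> boundary_paths E" for \<xi>
  proof (cases \<xi>)
    case (FPath w es)
    then have "w = u" "walk E u es" "singular E (walk_source E u es)"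
      using that by (auto simp: boundary_iff epaths_at_def)
    moreover from this(2) have "walk_source E u es \<in> S" using end_S[OF \<open>u \<in> S\<close>] by blast
    from S[OF this] have "\<not> singular E (walk_source E u es)" by (auto simp: singular_def)
    ultimately show ?thesis by blast
  qed auto
  have le: "is_prefix es \<zeta>" if xi: "\<xi> \<in> epaths_at E u" and z: "\<zeta> \<in> epaths_at E u" "\<zeta> \<in> boundary_paths E"
    and es: "is_prefix es \<xi>" for es \<xi> \<zeta>
  proof -
    obtain fs where fs: "length fs = length es" "is_prefix fs \<zeta>"
      using inf[OF z] ex_is_prefix_of_length by blast
    then have "fs = es" using uniq[OF \<open>u \<in> S\<close>] xi z(1) es unfolding epaths_at_iff by blast
    then show ?thesis using fs by simp
  qed
  show ?thesis
  proof (rule epath_eqI[of E])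
    show "prange E \<xi> = prange E \<zeta>" using xi z by (simp add: epaths_at_def)
  qed (use le xi z in blast)
qed

text \<open>The triple is (w, g, \<alpha>) with w = r(\<alpha>). Only one boundary path starts at w,
  so source and range of a germ over the boundary agree; the two paths of the triple differ in
  length, so no such germ is a unit.\<close>

lemma not_germs_free_if_not_Cyc:
  assumes "\<not> cond_Cyc G E"
  shows "\<not> germs_free G E (boundary_paths E) UNIV"
proof -
  obtain \<alpha> where \<alpha>: "G_cycle G E \<alpha>" "\<not> has_entrance E \<alpha>" using assms unfolding cond_Cyc_def by blast
  then obtain w as where a: "\<alpha> = FPath w as" "walk E w as" using fpathsE by (auto simp: G_cycle_def)
  obtain g where g: "g \<in> garr G" "gsrc G g = walk_source E w as" "grng G g = w" and "as \<noteq> []"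
    using \<alpha>(1) a by (auto simp: G_cycle_def zero_enat_def)
  have one: "e = f" if "u \<in> head E ` set as" "e \<in> edges_at E u" "f \<in> edges_at E u" for u e f
    using \<alpha>(2) that a by (auto simp: has_entrance_def)
  have w: "w \<in> head E ` set as" using \<open>as \<noteq> []\<close> a(2) by (cases as) (auto simp: edges_at_def)
  have on: "e \<in> edges_at E (head E e) \<and> tail E e \<in> insert (walk_source E w as) (head E ` set as)"
    if "e \<in> set as" for e
  proof -
    obtain xs ys where s: "as = xs @ e # ys" using \<open>e \<in> set as\<close> split_list by metis
    show ?thesis using a(2) unfolding s by (cases ys) (auto simp: edges_at_def)
  qed
  \<comment> \<open>The end of \<alpha> is only carried to w by g, so the vertices on \<alpha> need
    not be closed under following edges. Their G-orbit is.\<close>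
  define S where "S = {u. \<exists>h\<in>garr G. gsrc G h = u \<and> grng G h \<in> head E ` set as}"
  have S: "\<exists>e. edges_at E u = {e} \<and> tail E e \<in> S" if u: "u \<in> S" for u
  proof -
    obtain h where h: "h \<in> garr G" "gsrc G h = u" "grng G h \<in> head E ` set as"
      using u by (auto simp: S_def)
    obtain k where k: "k \<in> garr G" "gsrc G k = grng G h" "grng G k = gsrc G h"
      using inverseE[OF h(1)] by metis
    obtain d where d: "d \<in> set as" "head E d = grng G h" using h(3) by auto
    have d': "d \<in> edges_at E (grng G h)" using on[OF d(1)] d(2) by simp
    \<comment> \<open>The cycle edge at r(h) is pulled back to u by the inverse k of h. As h sends
      every edge at u to the only edge d at r(h), injectivity leaves no other edge at u.\<close>
    let ?e = "act G k d"
    have e: "?e \<in> edges_at E u" using act_edges_at(1)[OF k(1)] d' k h by simp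
    have img: "act G h f = d" if "f \<in> edges_at E u" for f
      using one[OF h(3) act_edges_at(1)[OF h(1)] d'] that h(2) by simp
    have "f = ?e" if f: "f \<in> edges_at E u" for f
      using act_list_inj[OF h(1), of "[f]" "[?e]"] h(2) f e img[OF f] img[OF e] by (auto dest: edges_atD)
    then have "edges_at E u = {?e}" using e by blast
    moreover have "tail E ?e \<in> S"
    proof -
      let ?h = "restr G h ?e"
      have r: "?h \<in> garr G" "gsrc G ?h = tail E ?e" "grng G ?h = tail E d"
        using act_edges_at(2-4)[OF h(1), of ?e] e h(2) img[OF e] by auto
      show ?thesis
      proof (cases "tail E d \<in> head E ` set as")
        case True
        then show ?thesis using r by (auto simp: S_def)
      next
        case False
        \<comment> \<open>Past the last edge of the cycle, composing with g leads back to w.\<close>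
        then have "tail E d = gsrc G g" using on[OF d(1)] g(2) by simp
        then show ?thesis using comp_closed[OF g(1) r(1)] src_comp[OF g(1) r(1)] rng_comp[OF g(1) r(1)]
            r g(3) w unfolding S_def by auto
      qed
    qed
    ultimately show ?thesis by blast
  qed
  have wS: "w \<in> S" using gid_closed[of w] walk_range[OF a(2)] w unfolding S_def by auto
  have V: "\<exists>\<zeta>. \<zeta> \<in> epaths_at E (gsrc G g) \<and> \<xi> = pcat (FPath w as) \<zeta> \<and> act_path G g \<zeta> = \<xi>"
    if xi: "\<xi> \<in> cylinder E (FPath w as)" "\<xi> \<in> boundary_paths E" for \<xi>
  proof -
    have xi': "\<xi> \<in> epaths_at E w" "is_prefix as \<xi>" using xi cylinder_iff[OF a(2)] by auto
    obtain \<zeta> where z: "\<zeta> \<in> epaths_at E (walk_source E w as)" "\<xi> = pcat (FPath w as) \<zeta>"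
      using is_prefix_split[OF xi'] .
    have "\<zeta> \<in> boundary_paths E" using boundary_pcat[OF a(2) z(1)] z xi by simp
    then have "act_path G g \<zeta> \<in> boundary_paths E" "act_path G g \<zeta> \<in> epaths_at E w"
      using act_path_boundary[OF g(1)] act_path_epaths_at[OF g(1)] z g by auto
    then have "act_path G g \<zeta> = \<xi>" using boundary_path_unique[OF S wS] xi xi' by blast
    then show ?thesis using z g by auto
  qed
  have wv: "walk E w []" using walk_range[OF a(2)] by simp
  show ?thesis
  proof (rule not_germs_freeI)
    show "walk E w []" "walk E w as" "g \<in> garr G" "grng G g = walk_source E w []"
      "gsrc G g = walk_source E w as" using a g wv by auto
    show "openin (path_topology E) (cylinder E (FPath w as))" using openin_cylinder a by simp
    show "cylinder E (FPath w as) \<inter> boundary_paths E \<noteq> {}"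
    proof -
      obtain \<zeta> where "pcat (FPath w as) \<zeta> \<in> boundary_paths E" "pcat (FPath w as) \<zeta> \<in> epaths_at E w"
        using ex_boundary_extension[OF a(2)] by blast
      then have "pcat (FPath w as) \<zeta> \<in> cylinder E (FPath w as)" using cylinder_iff[OF a(2)] by simp
      then show ?thesis using \<open>pcat (FPath w as) \<zeta> \<in> boundary_paths E\<close> by blast
    qed
    fix \<xi> assume xi: "\<xi> \<in> cylinder E (FPath w as)" "\<xi> \<in> boundary_paths E"
    obtain \<zeta> where z: "\<zeta> \<in> epaths_at E (gsrc G g)" "\<xi> = pcat (FPath w as) \<zeta>" "act_path G g \<zeta> = \<xi>"
      using V[OF xi] by blast
    have p: "prange E \<xi> = w" using xi cylinder_iff[OF a(2)] by (simp add: epaths_at_def)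
    have rep: "(FPath w [], g, FPath w as, \<xi>) \<in> germ_reps G E"
      using g a wv xi cylinder_iff[OF a(2)] by (simp add: germ_reps_iff)
    show "germ_range G E (germ G E (FPath w []) g (FPath w as) \<xi>) = \<xi>"
      using germ_range_germ[of w "[]" g w as \<zeta>] rep z g pcat_Nil[OF p] by simp
    show "germ G E (FPath w []) g (FPath w as) \<xi> \<noteq> germ_unit G E \<xi>"
    proof
      assume "germ G E (FPath w []) g (FPath w as) \<xi> = germ_unit G E \<xi>"
      then obtain ps where "act_list G g ps = as @ ps"
        unfolding germ_eq_unit_iff[OF rep] by auto
      then have "length ps = length (as @ ps)" by (metis length_act_list)
      then show False using \<open>as \<noteq> []\<close> by simp
    qed
  qed (use boundary_epaths in auto)
qed

section \<open>Sufficient conditions for topological freeness\<close>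

lemma isotropy_germ:
  assumes "(FPath a as, g, FPath b bs, pcat (FPath b bs) \<zeta>) \<in> germ_reps G E"
    and "\<zeta> \<in> epaths_at E (walk_source E b bs)"
    and "germ_range G E (germ G E (FPath a as) g (FPath b bs) (pcat (FPath b bs) \<zeta>)) = pcat (FPath b bs) \<zeta>"
  shows "a = b" "pcat (FPath a as) (act_path G g \<zeta>) = pcat (FPath b bs) \<zeta>"
proof -
  show e: "pcat (FPath a as) (act_path G g \<zeta>) = pcat (FPath b bs) \<zeta>"
    using germ_range_germ[OF assms(1,2)] assms(3) by simp
  note r = assms(1)[unfolded germ_reps_iff]
  have "prange E (pcat (FPath a as) (act_path G g \<zeta>)) = a"
    using prange_pcat[of a as] prange_act_path[of g \<zeta>] r assms(2) by simp
  moreover have "prange E (pcat (FPath b bs) \<zeta>) = b"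
    using prange_pcat[of b bs \<zeta>] r assms(2) by (simp add: epaths_at_def)
  ultimately show "a = b" using e by simp
qed

text \<open>Isotropy is assumed at boundary points only, so a finite \<open>zs\<close> is tested on
  a boundary path with prefix \<open>bs @ ys @ zs\<close>. Since |as| = |bs|, that path has two
  prefixes of equal length, which gives \<open>as = bs\<close> and shows that g fixes
  \<open>ys @ zs\<close>. Assuming so little makes the lemma usable for both unit spaces.\<close>

lemma Evr_unit_germ:
  assumes Evr: "cond_Evr G E" and ab: "walk E a as" "g \<in> garr G" "walk E b bs"
    "grng G g = walk_source E a as" "gsrc G g = walk_source E b bs" and len: "length as = length bs"
    and w: "walk E b (bs @ ys)"
    and iso: "\<And>\<xi>. \<xi> \<in> cylinder E (FPath b (bs @ ys)) \<Longrightarrow> \<xi> \<in> boundary_paths E \<Longrightarrow>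
      germ_range G E (germ G E (FPath a as) g (FPath b bs) \<xi>) = \<xi>"
  obtains \<xi> where "\<xi> \<in> cylinder E (FPath b (bs @ ys))" "\<xi> \<in> boundary_paths E"
    "germ G E (FPath a as) g (FPath b bs) \<xi> = germ_unit G E \<xi>"
proof -
  let ?u = "walk_source E b (bs @ ys)"
  have *: "\<exists>\<xi>. \<xi> \<in> cylinder E (FPath b (bs @ ys)) \<and> \<xi> \<in> boundary_paths E \<and>
      (FPath a as, g, FPath b bs, \<xi>) \<in> germ_reps G E \<and> is_prefix (bs @ ys @ zs) \<xi> \<and>
      a = b \<and> as = bs \<and> act_list G g (ys @ zs) = ys @ zs"
    if zs: "walk E ?u zs" for zs
  proof -
    have wz: "walk E b (bs @ ys @ zs)" using w zs by simp
    obtain \<omega> where o: "\<omega> \<in> epaths_at E (walk_source E b (bs @ ys @ zs))"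
      "pcat (FPath b (bs @ ys @ zs)) \<omega> \<in> boundary_paths E"
      "pcat (FPath b (bs @ ys @ zs)) \<omega> \<in> epaths_at E b"
      using ex_boundary_extension[OF wz] by metis
    define \<zeta> where "\<zeta> = pcat (FPath (walk_source E b bs) (ys @ zs)) \<omega>"
    have z: "\<zeta> \<in> epaths_at E (walk_source E b bs)"
      unfolding \<zeta>_def using wz o(1) by (intro pcat_epaths_at) auto
    have e: "pcat (FPath b (bs @ ys @ zs)) \<omega> = pcat (FPath b bs) \<zeta>"
      unfolding \<zeta>_def by (rule pcat_assoc)
    have p: "is_prefix (bs @ ys @ zs) (pcat (FPath b bs) \<zeta>)" unfolding e[symmetric] by simp
    then have p': "is_prefix (bs @ ys) (pcat (FPath b bs) \<zeta>)" "is_prefix bs (pcat (FPath b bs) \<zeta>)"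
      by (auto intro: is_prefix_append_left)
    have c: "pcat (FPath b bs) \<zeta> \<in> cylinder E (FPath b (bs @ ys))"
      using cylinder_iff[OF w] o(3) p'(1) e by simp
    have rep: "(FPath a as, g, FPath b bs, pcat (FPath b bs) \<zeta>) \<in> germ_reps G E"
      using ab o(3) e p'(2) by (simp add: germ_reps_iff)
    have "germ_range G E (germ G E (FPath a as) g (FPath b bs) (pcat (FPath b bs) \<zeta>)) = pcat (FPath b bs) \<zeta>"
      using iso[OF c] o(2) e by simp
    note i = isotropy_germ[OF rep z this]
    have "is_prefix (ys @ zs) \<zeta>" using p by simp
    then have "is_prefix (as @ act_list G g (ys @ zs)) (pcat (FPath a as) (act_path G g \<zeta>))"
      using is_prefix_act_path_act_list by (simp only: is_prefix_append_pcat)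
    then have "is_prefix (as @ act_list G g (ys @ zs)) (pcat (FPath b bs) \<zeta>)" by (simp only: i(2))
    from is_prefix_linear[OF this p] is_prefix_linear[OF p this] len
    have "as @ act_list G g (ys @ zs) = bs @ ys @ zs" by (simp add: prefix_order.antisym)
    then have "as = bs" "act_list G g (ys @ zs) = ys @ zs" using len by (auto simp: append_eq_append_conv)
    then show ?thesis using c o(2) e rep p i(1) by auto
  qed
  have u: "?u \<in> verts E" using walk_source_verts[OF w] .
  have base: "a = b" "as = bs" "act_list G g ys = ys" using *[of "[]"] u by auto
  have wy: "walk E (gsrc G g) ys" using w ab by simp
  \<comment> \<open>(Evr) is applied past \<open>ys\<close>, because isotropy is known only inside
    the smaller cylinder.\<close>
  define h where "h = restr_list G g ys"
  have h: "h \<in> garr G" "gsrc G h = ?u" "grng G h = ?u"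
    unfolding h_def using act_list_closed[OF ab(2) wy] ab base by auto
  have "fixes_path G E h \<mu>" if \<mu>: "\<mu> \<in> fpaths_at E (gsrc G h)" for \<mu>
  proof -
    obtain zs where zs: "\<mu> = FPath ?u zs" "walk E ?u zs" using \<mu> h by (auto simp: fpaths_at_iff)
    have "act_list G g (ys @ zs) = ys @ zs" using *[OF zs(2)] by blast
    then have "act_list G h zs = zs" using base by (simp add: h_def)
    then show ?thesis using zs h by (simp add: fixes_path_def epaths_at_def)
  qed
  then obtain \<mu> where "\<mu> \<in> fpaths_at E (gsrc G h)" "strongly_fixes G E h \<mu>"
    using Evr h(1) unfolding cond_Evr_def by blast
  then obtain zs where zs: "walk E ?u zs" "restr_list G h zs = gid G (walk_source E ?u zs)"
    using h by (auto simp: fpaths_at_iff strongly_fixes_def)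
  obtain \<xi> where xi: "\<xi> \<in> cylinder E (FPath b (bs @ ys))" "\<xi> \<in> boundary_paths E"
    "(FPath a as, g, FPath b bs, \<xi>) \<in> germ_reps G E" "is_prefix (bs @ ys @ zs) \<xi>"
    "act_list G g (ys @ zs) = ys @ zs" using *[OF zs(1)] by blast
  have "restr_list G g (ys @ zs) = gid G (walk_source E b (bs @ ys @ zs))"
    using zs(2) by (simp add: h_def)
  then have "germ G E (FPath a as) g (FPath b bs) \<xi> = germ_unit G E \<xi>"
    unfolding germ_eq_unit_iff[OF xi(3)] using base(1,2) xi(4,5) by metis
  then show ?thesis using that xi by blast
qed

lemma cylinder_prefix:
  assumes "walk E b xs" "cylinder E (FPath b xs) \<subseteq> cylinder E (FPath b bs)" "walk E b bs"
  obtains ys where "xs = bs @ ys"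
proof -
  have "FPath b xs \<in> cylinder E (FPath b xs)" using assms by (simp add: cylinder_iff epaths_at_def)
  then have "prefix bs xs" using assms(2) cylinder_iff[OF assms(3)] by auto
  then show ?thesis using that by (auto simp: prefix_def)
qed

lemma germs_free_boundary_if_Evr:
  assumes Evr: "cond_Evr G E" and B: "B = germs0 G E \<or> B = germs00 G E"
  shows "germs_free G E (boundary_paths E) B"
proof (rule ccontr)
  assume "\<not> germs_free G E (boundary_paths E) B"
  then obtain a as g b bs V \<xi> where ab: "walk E a as" "g \<in> garr G" "walk E b bs"
    "grng G g = walk_source E a as" "gsrc G g = walk_source E b bs"
    and V: "openin (path_topology E) V" "V \<subseteq> cylinder E (FPath b bs)"
    "\<xi> \<in> V" "\<xi> \<in> boundary_paths E" and len: "length as = length bs"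
    and iso: "\<And>\<zeta>. \<zeta> \<in> V \<Longrightarrow> \<zeta> \<in> boundary_paths E \<Longrightarrow> germ_range G E (germ G E (FPath a as) g (FPath b bs) \<zeta>) = \<zeta>"
    and ne: "\<And>\<zeta>. \<zeta> \<in> V \<Longrightarrow> \<zeta> \<in> boundary_paths E \<Longrightarrow> germ G E (FPath a as) g (FPath b bs) \<zeta> \<noteq> germ_unit G E \<zeta>"
    using not_germs_freeE[of "boundary_paths E" B] B by metis
  have "prange E \<xi> = b" using V(2,3) cylinder_iff[OF ab(3)] by (auto simp: epaths_at_def)
  then obtain xs where xs: "walk E b xs" "cylinder E (FPath b xs) \<subseteq> V"
    using boundary_nbhd_cylinder[OF V(1,3,4)] by metis
  obtain ys where ys: "xs = bs @ ys" using cylinder_prefix[OF xs(1) _ ab(3)] xs(2) V(2) by blast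
  show False
    by (rule Evr_unit_germ[OF Evr ab _ xs(1)[unfolded ys]]) (use len xs(2) ys iso ne in auto)
qed

text \<open>Every case produces a finite path in V. Isotropy at this point forces |as| = |bs| by
  counting edges, which takes the place of (Cyc).\<close>

lemma germs_free_epaths_if_Evr_Rec:
  assumes Evr: "cond_Evr G E" and Rec: "cond_Rec G E"
    and B: "B = UNIV \<or> B = germs0 G E \<or> B = germs00 G E"
  shows "germs_free G E (epaths E) B"
proof (rule ccontr)
  assume "\<not> germs_free G E (epaths E) B"
  then obtain a as g b bs V \<xi> where ab: "walk E a as" "g \<in> garr G" "walk E b bs"
    "grng G g = walk_source E a as" "gsrc G g = walk_source E b bs"
    and V: "openin (path_topology E) V" "V \<subseteq> cylinder E (FPath b bs)"
    "\<xi> \<in> V" "\<xi> \<in> epaths E"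
    and iso: "\<And>\<zeta>. \<zeta> \<in> V \<Longrightarrow> \<zeta> \<in> epaths E \<Longrightarrow> germ_range G E (germ G E (FPath a as) g (FPath b bs) \<zeta>) = \<zeta>"
    and ne: "\<And>\<zeta>. \<zeta> \<in> V \<Longrightarrow> \<zeta> \<in> epaths E \<Longrightarrow> germ G E (FPath a as) g (FPath b bs) \<zeta> \<noteq> germ_unit G E \<zeta>"
    using not_germs_freeE[of "epaths E" B] B by metis
  have b: "prange E \<xi> = b" using V(2,3) cylinder_iff[OF ab(3)] by (auto simp: epaths_at_def)
  have fin: "a = b \<and> as = bs \<and> act_list G g ys = ys \<and>
      (FPath a as, g, FPath b bs, FPath b (bs @ ys)) \<in> germ_reps G E"
    if v: "FPath b (bs @ ys) \<in> V" and w: "walk E b (bs @ ys)" for ys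
  proof -
    let ?z = "FPath (walk_source E b bs) ys"
    have z: "?z \<in> epaths_at E (walk_source E b bs)" using w by (simp add: epaths_at_def)
    have rep: "(FPath a as, g, FPath b bs, pcat (FPath b bs) ?z) \<in> germ_reps G E"
      using ab w by (simp add: germ_reps_iff epaths_at_def)
    have "germ_range G E (germ G E (FPath a as) g (FPath b bs) (pcat (FPath b bs) ?z)) = pcat (FPath b bs) ?z"
      using iso[OF v] w by simp
    note i = isotropy_germ[OF rep z this]
    then have e: "as @ act_list G g ys = bs @ ys" by simp
    then have "length as = length bs" using arg_cong[OF e, of length] by simp
    then show ?thesis using e i rep by (auto simp: append_eq_append_conv)
  qed
  show False
  proof (cases "\<xi> \<in> boundary_paths E")
    case True
    then obtain xs where xs: "walk E b xs" "cylinder E (FPath b xs) \<subseteq> V"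
      using boundary_nbhd_cylinder[OF V(1,3)] b by metis
    obtain ys where ys: "xs = bs @ ys" using cylinder_prefix[OF xs(1) _ ab(3)] xs(2) V(2) by blast
    have "FPath b xs \<in> V" using xs by (auto simp: cylinder_iff epaths_at_def)
    then have "length as = length bs" using fin[of ys] xs(1) ys by auto
    then show False
      using Evr_unit_germ[OF Evr ab _ xs(1)[unfolded ys]] xs(2) ys iso ne boundary_epaths
      by (metis subsetD)
  next
    case False
    then obtain xs where xs: "\<xi> = FPath b xs" "walk E b xs" "\<not> singular E (walk_source E b xs)"
      using V(4) b by (cases \<xi>) (auto simp: boundary_iff)
    have "\<xi> \<in> cylinder E (FPath b bs)" using V(2,3) by blast
    then have "prefix bs xs" using xs(1) cylinder_iff[OF ab(3)] by simp
    then obtain ys where ys: "xs = bs @ ys" by (auto simp: prefix_def)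
    have f: "a = b" "as = bs" "act_list G g ys = ys"
      and rep: "(FPath a as, g, FPath b bs, \<xi>) \<in> germ_reps G E"
      using fin[of ys] V(3) xs ys by auto
    \<comment> \<open>Off the boundary, \<xi> itself is finite and ends in a finite receiver. (Rec)
      therefore applies to the part \<open>ys\<close> of \<xi> after \<open>bs\<close>, which g
      fixes.\<close>
    have "fixes_path G E g (FPath (gsrc G g) ys)"
      using f ab xs(2) ys by (simp add: fixes_path_def epaths_at_def)
    moreover have "finite_receiver E (psource E (FPath (gsrc G g) ys))"
      using xs(3) ys ab walk_source_verts[OF xs(2)] by (simp add: finite_receiver_def singular_def)
    moreover have "FPath (gsrc G g) ys \<in> fpaths E" using xs(2) ys ab by simp
    ultimately have "strongly_fixes G E g (FPath (gsrc G g) ys)"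
      using Rec ab(2) unfolding cond_Rec_def by blast
    then have "restr_list G g ys = gid G (walk_source E b (bs @ ys))"
      using ab by (simp add: strongly_fixes_def)
    moreover have "is_prefix (bs @ ys) \<xi>" using xs ys by simp
    ultimately have "germ G E (FPath a as) g (FPath b bs) \<xi> = germ_unit G E \<xi>"
      unfolding germ_eq_unit_iff[OF rep] using f by metis
    then show False using ne V by blast
  qed
qed

text \<open>If \<open>g\<zeta> = \<nu>\<zeta>\<close> for all boundary paths \<open>\<zeta>\<close> at \<open>s(g)\<close>, then the first \<open>k\<close> edges of \<open>\<zeta>\<close>
  determine the first \<open>k + |\<nu>|\<close> edges of \<open>g\<zeta>\<close>, hence those of \<open>\<zeta>\<close>. So \<open>s(g)\<close> and \<open>r(g)\<close> have only
  one boundary path each, which an entrance to \<open>\<nu>\<close> would contradict.\<close>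

lemma no_entrance:
  assumes g: "g \<in> garr G" and ns: "walk E (grng G g) ns" "ns \<noteq> []" "walk_source E (grng G g) ns = gsrc G g"
    and eq: "\<And>\<zeta>. \<zeta> \<in> epaths_at E (gsrc G g) \<Longrightarrow> \<zeta> \<in> boundary_paths E \<Longrightarrow>
      act_path G g \<zeta> = pcat (FPath (grng G g) ns) \<zeta>"
  shows "\<not> has_entrance E (FPath (grng G g) ns)"
proof -
  let ?Z = "\<lambda>v. epaths_at E v \<inter> boundary_paths E"
  have le: "is_prefix es \<zeta>'" if "\<zeta> \<in> ?Z (gsrc G g)" "\<zeta>' \<in> ?Z (gsrc G g)" "is_prefix es \<zeta>" for \<zeta> \<zeta>' es
    using that(3)
  proof (induction "length es" arbitrary: es rule: less_induct)
    case less
    let ?p = "pcat (FPath (grng G g) ns)"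
    have "is_prefix (act_list G g es) (?p \<zeta>)"
      using is_prefix_act_path_act_list[OF less.prems] eq that by (metis IntD1 IntD2)
    then consider "prefix (act_list G g es) ns" | es' where "act_list G g es = ns @ es'" "is_prefix es' \<zeta>"
      using is_prefix_pcat by metis
    then have "is_prefix (act_list G g es) (?p \<zeta>')"
    proof cases
      case 1
      then show ?thesis by (simp add: is_prefix_pcat)
    next
      case 2
      have "length es = length ns + length es'" using 2(1) by (metis length_act_list length_append)
      then have "is_prefix es' \<zeta>'" using less.hyps[OF _ 2(2)] ns(2) by simp
      then show ?thesis using 2(1) by simp
    qed
    then have "is_prefix (act_list G g es) (act_path G g \<zeta>')" using eq that by simp
    then obtain fs where fs: "is_prefix fs \<zeta>'" "act_list G g es = act_list G g fs"
      using is_prefix_act_path by metis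
    have "es = fs"
      using act_list_inj[OF g _ _ fs(2)] fs(1) less.prems that(1,2) unfolding Int_iff epaths_at_iff by blast
    then show ?case using fs by simp
  qed
  have uniq_s: "\<zeta> = \<zeta>'" if "\<zeta> \<in> ?Z (gsrc G g)" "\<zeta>' \<in> ?Z (gsrc G g)" for \<zeta> \<zeta>'
  proof (rule epath_eqI[of E])
    show "prange E \<zeta> = prange E \<zeta>'" using that by (simp add: epaths_at_def)
  qed (use le that in blast)
  obtain h where h: "h \<in> garr G" "gsrc G h = grng G g" "grng G h = gsrc G g"
    "gcomp G h g = gid G (gsrc G g)" "gcomp G g h = gid G (grng G g)" using inverseE[OF g] by metis
  \<comment> \<open>The inverse of g carries boundary paths at r(g) to those at s(g), where
    uniqueness is known.\<close>
  have uniq_r: "\<zeta> = \<zeta>'" if z: "\<zeta> \<in> ?Z (grng G g)" "\<zeta>' \<in> ?Z (grng G g)" for \<zeta> \<zeta>'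
  proof -
    have inv: "act_path G g (act_path G h \<omega>) = \<omega>" and mem: "act_path G h \<omega> \<in> ?Z (gsrc G g)"
      if "\<omega> \<in> ?Z (grng G g)" for \<omega>
    proof -
      have o: "\<omega> \<in> epaths_at E (gsrc G h)" "\<omega> \<in> boundary_paths E" using that h(2) by auto
      show "act_path G h \<omega> \<in> ?Z (gsrc G g)"
        using act_path_epaths_at[OF h(1) o(1)] act_path_boundary[OF h(1) o] h(3) by simp
      show "act_path G g (act_path G h \<omega>) = \<omega>"
        using h o(1) by (intro act_path_inverse[OF h(1) g]) auto
    qed
    have "act_path G h \<zeta> = act_path G h \<zeta>'" by (rule uniq_s[OF mem[OF z(1)] mem[OF z(2)]])
    then show ?thesis using inv[OF z(1)] inv[OF z(2)] by metis
  qed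
  \<comment> \<open>Two edges at the end of the walk \<open>xs\<close> would extend to two different
    boundary paths at v.\<close>
  have edge: "e = f" if uniq: "\<And>\<zeta> \<zeta>'. \<zeta> \<in> ?Z v \<Longrightarrow> \<zeta>' \<in> ?Z v \<Longrightarrow> \<zeta> = \<zeta>'" and xs: "walk E v xs"
    and ef: "e \<in> edges_at E (walk_source E v xs)" "f \<in> edges_at E (walk_source E v xs)" for v xs e f
  proof -
    have ex: "\<exists>\<zeta> \<in> ?Z v. is_prefix (xs @ [d]) \<zeta>" if d: "d \<in> edges_at E (walk_source E v xs)" for d
    proof -
      have "walk E v (xs @ [d])" using xs d by (auto dest: edges_atD)
      then obtain \<zeta> where "pcat (FPath v (xs @ [d])) \<zeta> \<in> boundary_paths E"
        "pcat (FPath v (xs @ [d])) \<zeta> \<in> epaths_at E v" using ex_boundary_extension by blast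
      then show ?thesis by (intro bexI[of _ "pcat (FPath v (xs @ [d])) \<zeta>"]) simp_all
    qed
    obtain \<zeta> where z: "\<zeta> \<in> ?Z v" "is_prefix (xs @ [e]) \<zeta>" using ex[OF ef(1)] by (rule bexE)
    obtain \<zeta>' where z': "\<zeta>' \<in> ?Z v" "is_prefix (xs @ [f]) \<zeta>'" using ex[OF ef(2)] by (rule bexE)
    have "\<zeta> = \<zeta>'" by (rule uniq[OF z(1) z'(1)])
    with z(2) z'(2) have "is_prefix (xs @ [e]) \<zeta>" "is_prefix (xs @ [f]) \<zeta>" by simp_all
    then have "prefix (xs @ [e]) (xs @ [f])" using is_prefix_linear by fastforce
    then show ?thesis by simp
  qed
  show ?thesis
  proof
    assume "has_entrance E (FPath (grng G g) ns)"
    then obtain v e f where v: "v = gsrc G g \<or> v \<in> head E ` set ns" "e \<in> edges_at E v" "f \<in> edges_at E v" "e \<noteq> f"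
      using ns(3) by (auto simp: has_entrance_def)
    \<comment> \<open>The end of \<open>ns\<close> is s(g), handled by the empty walk there; the
      range of an edge of \<open>ns\<close> is reached from r(g) by an initial piece of
      \<open>ns\<close>.\<close>
    from v(1) show False
    proof
      assume "v = gsrc G g"
      then show False using edge[of "gsrc G g" "[]" e f, OF uniq_s] v src_closed[OF g] objects_eq_verts by simp
    next
      assume "v \<in> head E ` set ns"
      then obtain d where d: "d \<in> set ns" "v = head E d" by blast
      then obtain xs ys where s: "ns = xs @ d # ys" using split_list by metis
      then have "walk E (grng G g) xs" "walk_source E (grng G g) xs = v"
        using ns(1) d by (auto simp: edges_at_def)
      then show False using edge[of "grng G g" xs e f, OF uniq_r] v by simp
    qed
  qed
qed

lemma Cyc_no_shift:
  assumes Cyc: "cond_Cyc G E" and g: "g \<in> garr G"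
    and ns: "walk E (grng G g) ns" "ns \<noteq> []" "walk_source E (grng G g) ns = gsrc G g"
  obtains \<zeta> where "\<zeta> \<in> epaths_at E (gsrc G g)" "\<zeta> \<in> boundary_paths E"
      "act_path G g \<zeta> \<noteq> pcat (FPath (grng G g) ns) \<zeta>"
proof -
  have "G_cycle G E (FPath (grng G g) ns)"
    using g ns by (auto simp: G_cycle_def zero_enat_def intro!: bexI[of _ g])
  then show ?thesis using no_entrance[OF g ns] Cyc that unfolding cond_Cyc_def by blast
qed

lemma germs_free_boundary_if_Evr_Cyc:
  assumes Evr: "cond_Evr G E" and Cyc: "cond_Cyc G E"
  shows "germs_free G E (boundary_paths E) UNIV"
proof (rule ccontr)
  assume "\<not> germs_free G E (boundary_paths E) UNIV"
  then obtain a as g b bs V \<xi> where ab: "walk E a as" "g \<in> garr G" "walk E b bs"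
    "grng G g = walk_source E a as" "gsrc G g = walk_source E b bs"
    and V: "openin (path_topology E) V" "V \<subseteq> cylinder E (FPath b bs)"
    "\<xi> \<in> V" "\<xi> \<in> boundary_paths E"
    and iso: "\<And>\<zeta>. \<zeta> \<in> V \<Longrightarrow> \<zeta> \<in> boundary_paths E \<Longrightarrow> germ_range G E (germ G E (FPath a as) g (FPath b bs) \<zeta>) = \<zeta>"
    and ne: "\<And>\<zeta>. \<zeta> \<in> V \<Longrightarrow> \<zeta> \<in> boundary_paths E \<Longrightarrow> germ G E (FPath a as) g (FPath b bs) \<zeta> \<noteq> germ_unit G E \<zeta>"
    using not_germs_freeE[of "boundary_paths E" UNIV] by metis
  have "prange E \<xi> = b" using V(2,3) cylinder_iff[OF ab(3)] by (auto simp: epaths_at_def)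
  then obtain xs where xs: "walk E b xs" "cylinder E (FPath b xs) \<subseteq> V"
    using boundary_nbhd_cylinder[OF V(1,3,4)] by metis
  obtain ys where ys: "xs = bs @ ys" using cylinder_prefix[OF xs(1) _ ab(3)] xs(2) V(2) by blast
  show False
  proof (cases "length as = length bs")
    case True
    then show False
      by (rule Evr_unit_germ[OF Evr ab _ xs(1)[unfolded ys]]) (use xs(2) ys iso ne in auto)
  next
    case False
    have wy: "walk E (gsrc G g) ys" using xs(1) ys ab by simp
    \<comment> \<open>Passing from \<beta> to the longer path \<open>xs\<close> replaces \<alpha> by
      \<open>cs\<close> and g by its restriction h. Now the whole cylinder of \<open>xs\<close> lies
      in V, so isotropy holds for every boundary path \<zeta> at s(h).\<close>
    define h where "h = restr_list G g ys"
    define cs where "cs = as @ act_list G g ys"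
    note c = act_list_closed[OF ab(2) wy]
    have h: "h \<in> garr G" "gsrc G h = walk_source E b xs" "grng G h = walk_source E a cs" "walk E a cs"
      using c ab ys by (auto simp: h_def cs_def)
    have len: "length cs \<noteq> length xs" using False ys by (simp add: cs_def)
    have eq: "a = b \<and> pcat (FPath a cs) (act_path G h \<zeta>) = pcat (FPath b xs) \<zeta>"
      if z: "\<zeta> \<in> epaths_at E (gsrc G h)" "\<zeta> \<in> boundary_paths E" for \<zeta>
    proof -
      define \<omega> where "\<omega> = pcat (FPath (gsrc G g) ys) \<zeta>"
      have e: "pcat (FPath b xs) \<zeta> = pcat (FPath b bs) \<omega>"
        unfolding \<omega>_def ys by (rule pcat_assoc)
      have zx: "\<zeta> \<in> epaths_at E (walk_source E b xs)" using z h by simp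
      have o: "\<omega> \<in> epaths_at E (walk_source E b bs)"
        unfolding \<omega>_def ab(5)[symmetric] using wy zx ys ab by (intro pcat_epaths_at) auto
      have xz: "pcat (FPath b xs) \<zeta> \<in> boundary_paths E" "pcat (FPath b xs) \<zeta> \<in> epaths_at E b"
        using boundary_pcat[OF xs(1) zx] z pcat_epaths_at[OF xs(1) zx] by auto
      then have "pcat (FPath b xs) \<zeta> \<in> V" using xs(2) cylinder_iff[OF xs(1)] by auto
      then have r: "germ_range G E (germ G E (FPath a as) g (FPath b bs) (pcat (FPath b bs) \<omega>)) = pcat (FPath b bs) \<omega>"
        using iso xz e by metis
      have rep: "(FPath a as, g, FPath b bs, pcat (FPath b bs) \<omega>) \<in> germ_reps G E"
        using ab xz(2) e by (simp add: germ_reps_iff)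
      note i = isotropy_germ[OF rep o r]
      have "pcat (FPath a as) (act_path G g \<omega>) = pcat (FPath a cs) (act_path G h \<zeta>)"
        unfolding \<omega>_def act_path_pcat cs_def h_def by (rule pcat_assoc[symmetric])
      then show ?thesis using i e by simp
    qed
    \<comment> \<open>One boundary path suffices to compare \<open>cs\<close> and \<open>xs\<close>:
      both are prefixes of the same path.\<close>
    obtain \<zeta>0 where z0: "\<zeta>0 \<in> epaths_at E (gsrc G h)" "\<zeta>0 \<in> boundary_paths E"
      using ex_boundary_path src_closed[OF h(1)] objects_eq_verts by metis
    have "a = b" using eq z0 by blast
    have "is_prefix cs (pcat (FPath b xs) \<zeta>0)" using eq[OF z0] is_prefix_self_pcat by metis
    then consider ns where "xs = cs @ ns" | ns where "cs = xs @ ns"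
      using is_prefix_cases[of cs _ xs] is_prefix_self_pcat by metis
    then show False
    proof cases
      case 1
      have n: "walk E (grng G h) ns" "ns \<noteq> []" "walk_source E (grng G h) ns = gsrc G h"
        using 1 len xs(1) h \<open>a = b\<close> by auto
      obtain \<zeta> where z: "\<zeta> \<in> epaths_at E (gsrc G h)" "\<zeta> \<in> boundary_paths E"
        "act_path G h \<zeta> \<noteq> pcat (FPath (grng G h) ns) \<zeta>" using Cyc_no_shift[OF Cyc h(1) n] .
      have "pcat (FPath a cs) (act_path G h \<zeta>) = pcat (FPath a cs) (pcat (FPath (grng G h) ns) \<zeta>)"
        using eq[OF z(1,2)] \<open>a = b\<close> unfolding 1 by (metis pcat_assoc)
      moreover have "prange E (act_path G h \<zeta>) = prange E (pcat (FPath (grng G h) ns) \<zeta>)"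
        using prange_act_path[OF h(1) z(1)] prange_pcat[OF n(1)] n(3) z(1) by (simp add: epaths_at_def)
      ultimately have "act_path G h \<zeta> = pcat (FPath (grng G h) ns) \<zeta>" by (rule pcat_left_cancel)
      then show False using z(3) by contradiction
    next
      case 2
      \<comment> \<open>Here cancelling \<open>xs\<close> gives ns(h\<zeta>) = \<zeta>, so it is the
        inverse k of h that satisfies k\<omega> = ns\<omega>, and (Cyc) is applied to k.\<close>
      obtain k where k: "k \<in> garr G" "gsrc G k = grng G h" "grng G k = gsrc G h"
        "gcomp G k h = gid G (gsrc G h)" "gcomp G h k = gid G (grng G h)" using inverseE[OF h(1)] by metis
      have n: "walk E (grng G k) ns" "ns \<noteq> []" "walk_source E (grng G k) ns = gsrc G k"
        using 2 len xs(1) h k \<open>a = b\<close> by auto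
      obtain \<omega> where o: "\<omega> \<in> epaths_at E (gsrc G k)" "\<omega> \<in> boundary_paths E"
        "act_path G k \<omega> \<noteq> pcat (FPath (grng G k) ns) \<omega>" using Cyc_no_shift[OF Cyc k(1) n] .
      have z: "act_path G k \<omega> \<in> epaths_at E (gsrc G h)" "act_path G k \<omega> \<in> boundary_paths E"
        using act_path_epaths_at[OF k(1) o(1)] act_path_boundary[OF k(1) o(1,2)] k by auto
      have "act_path G h (act_path G k \<omega>) = \<omega>"
        using k o(1) by (intro act_path_inverse[OF k(1) h(1)]) auto
      then have "pcat (FPath b xs) (act_path G k \<omega>) = pcat (FPath b xs) (pcat (FPath (grng G k) ns) \<omega>)"
        using eq[OF z] \<open>a = b\<close> unfolding 2 by (metis pcat_assoc)
      moreover have "prange E (act_path G k \<omega>) = prange E (pcat (FPath (grng G k) ns) \<omega>)"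
        using prange_act_path[OF k(1) o(1)] prange_pcat[OF n(1)] n(3) o(1) by (simp add: epaths_at_def)
      ultimately have "act_path G k \<omega> = pcat (FPath (grng G k) ns) \<omega>" by (rule pcat_left_cancel)
      then show False using o(3) by contradiction
    qed
  qed
qed

end

theorem theorem6p24:
  fixes G :: "('v, 'g, 'e) self_similar" and E :: "('v, 'e) pre_digraph"
  assumes "self_similar_action G E"
  shows "(topologically_free (tight_groupoid G E) \<longleftrightarrow> cond_Evr G E \<and> cond_Cyc G E) \<and>
    (topologically_free (tight_groupoid0 G E) \<longleftrightarrow> cond_Evr G E) \<and>
    (topologically_free (tight_groupoid00 G E) \<longleftrightarrow> cond_Evr G E) \<and>
    (topologically_free (groupoid_tilde G E) \<longleftrightarrow> cond_Evr G E \<and> cond_Rec G E) \<and>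
    (topologically_free (groupoid0_tilde G E) \<longleftrightarrow> cond_Evr G E \<and> cond_Rec G E) \<and>
    (topologically_free (groupoid00_tilde G E) \<longleftrightarrow> cond_Evr G E \<and> cond_Rec G E)"
proof -
  interpret self_similar_action G E by fact
  have tilde: "germs_free G E (epaths E) B \<longleftrightarrow> cond_Evr G E \<and> cond_Rec G E"
    if B: "B = UNIV \<or> B = germs0 G E \<or> B = germs00 G E" for B
    using not_germs_free_if_not_Evr[OF _ _ B, of "epaths E"] not_germs_free_if_not_Rec[OF _ B]
      germs_free_epaths_if_Evr_Rec[OF _ _ B] by auto
  have tight: "germs_free G E (boundary_paths E) B \<longleftrightarrow> cond_Evr G E"
    if B: "B = germs0 G E \<or> B = germs00 G E" for B
    using not_germs_free_if_not_Evr[of "boundary_paths E" B] germs_free_boundary_if_Evr[OF _ B] B by auto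
  have "germs_free G E (boundary_paths E) UNIV \<longleftrightarrow> cond_Evr G E \<and> cond_Cyc G E"
    using not_germs_free_if_not_Evr[of "boundary_paths E" UNIV] not_germs_free_if_not_Cyc
      germs_free_boundary_if_Evr_Cyc by auto
  then show ?thesis unfolding topologically_free_iff_germs_free using tilde tight by simp
qed

end
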